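(* Let $(K,V_i)_{i=0}^{N-1}$ be a row co-isometry and let $(H,S_i)_{i=0}^{N-1}$ be its Cuntz dilation. Suppose there is a closed subspace $K_0$ of $K$ such that $(V_i)$ acts on $K_0$ as an irreducible random walk $(M,\{g_i\},\{\nu_i\})$ with orthonormal basis $(e_c)_{c\in M}$. Assume in addition that $(V_i)$ is simple on $K_0$. Fix a point $c\in M$. Let $\Omega_c^{(0)}$ be the set of words $\omega\in\Omega$ that do not end in a cycle word for $c$ (in particular the empty word is in $\Omega_c^{(0)}$), and for $n\ge 1$ let $\Omega_c^{(n)}$ be the set of words that end in exactly $n$ cycle words for $c$, i.e. words of the form $\omega=\omega_0\beta_1\cdots\beta_n$ with $\omega_0\in\Omega_c^{(0)}$ and $\beta_1,\dots,\beta_n$ cycle words for $c$. For $n\ge 0$ let $\mathcal E_c^{(n)}:=\{S_\omega e_c:\omega\in\Omega_c^{(n)}\}$ and let $H_c^{(n)}$ be the closed linear span of $\mathcal E_c^{(n)}$. Then: (a) $\mathcal E_c^{(n)}$ is an orthonormal basis for $H_c^{(n)}$, for all $n\ge 0$. (b) $H_c^{(n)}\subseteq H_c^{(n+1)}$ for all $n\ge 0$. (c) $\bigcup_{n\ge 0}\mathcal E_c^{(n)}=\{S_\omega e_c:\omega\in\Omega\}$. (d) Let $V:=\overline{\operatorname{span}}\{S_\omega e_c:\omega\in\Omega\}=\overline{\bigcup_{n\ge 0}H_c^{(n)}}$. Then $V$ is invariant for the Cuntz representation $(S_i)$ (i.e. $S_iV\subseteq V$ and $S_i^*V\subseteq V$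 for all $i$). Also, $(V,S_i|_V)_{i=0}^{N-1}$ is the Cuntz dilation of the row co-isometry $(K_0,P_{K_0}V_iP_{K_0})_{i=0}^{N-1}$, and it is irreducible. In addition, the following statements are equivalent: (i) $\overline{\operatorname{span}}\{S_\omega e_c:\omega\in\Omega\}=H$. (ii) The Cuntz representation $(H,S_i)_{i=0}^{N-1}$ is irreducible. (iii) The only bounded operators $T:K\to K$ with $\sum_{i=0}^{N-1}V_iTV_i^*=T$ are $T=\lambda I_K$, $\lambda\in\mathbb C$. If $(V_i)$ is reversing on the random walk, then we also have: (e) For all $n\ge 0$ and all $v\in K$, $$\|P_{H_c^{(n)}}v\|^2=\sum_{\omega\in\Omega_c^{(0)}}|\langle V_\omega e_c,v\rangle|^2=\|P_{H_c^{(0)}}v\|^2=\|P_Vv\|^2,$$ and the statements (i)--(iii) are equivalent to (iv) $\{V_\omega e_c:\omega\in\Omega_c^{(0)}\}$ is a Parseval frame for $K$.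
   Context: Row co-isometry: a Hilbert space $K$ with bounded operators $V_0,\dots,V_{N-1}$ on $K$ ($N\ge 2$) satisfying $\sum_{i=0}^{N-1}V_iV_i^*=I_K$. Representation of the Cuntz algebra $\mathcal O_N$ (Cuntz isometries): bounded operators $S_0,\dots,S_{N-1}$ on a Hilbert space $H$ with $\sum_iS_iS_i^*=I_H$ and $S_j^*S_i=\delta_{j,i}I_H$. It is irreducible if the only bounded operators on $H$ commuting with all $S_i,S_i^*$ are scalar multiples of $I_H$ (equivalently, the only closed subspaces invariant under all $S_i$ and $S_i^*$ are $\{0\}$ and $H$). Cuntz dilation of $(K,V_i)$: the representation $(H,S_i)_{i=0}^{N-1}$ of $\mathcal O_N$, unique up to unitary equivalence, on a Hilbert space $H\supseteq K$ such that $K$ is cyclic for the representation, $S_i^*K\subseteq K$ and $V_i^*=S_i^*|_K$ (so $V_i=P_KS_i|_K$) for all $i$. Its existence and uniqueness are known. $P_L$ denotes the orthogonal projection onto a closed subspace $L$. $\Omega$ is the set of all finite words over $\{0,\dots,N-1\}$, including the empty word; for $\omega=\omega_1\cdots\omega_n$, $V_\omega=V_{\omega_1}\cdots V_{\omega_n}$, $S_\omega=S_{\omega_1}\cdots S_{\omega_n}$, and $V_\emptyset=I$, $S_\emptyset=I$. $(V_i)$ acts on a closed subspace $K_0\subseteq K$ as a random walk $(M,\{g_i\},\{\nu_i\})$ if: (1) $V_i^*K_0\subseteq K_0$ for all $i$; (2) there are an orthonormal basis $(e_c)_{c\in M}$ of $K_0$ with $M$ finite, and maps $\nu_i:M\to\mathbb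 C$, $g_i:M\to M$ with $V_i^*e_c=\nu_i(c)e_{g_i(c)}$ for all $i$ and $c\in M$; (3) whenever $\nu_i(c_1)\ne0$, $\nu_i(c_2)\ne 0$ and $g_i(c_1)=g_i(c_2)$, then $c_1=c_2$. For $\omega=\omega_1\cdots\omega_n$: $g_\omega=g_{\omega_n}\circ\cdots\circ g_{\omega_1}$ and $\nu_\omega(c)=\nu_{\omega_1}(c)\nu_{\omega_2}(g_{\omega_1}(c))\cdots\nu_{\omega_n}(g_{\omega_{n-1}}\cdots g_{\omega_1}(c))$; $g_\emptyset=\mathrm{id}$, $\nu_\emptyset=1$. The random walk is irreducible if for all $c_1,c_2\in M$ there is $\omega\in\Omega$ with $g_\omega(c_1)=c_2$ and $\nu_\omega(c_1)\neq0$. $(V_i)$ is simple on $K_0$ if the only operators $T:K_0\to K_0$ with $P_{K_0}\big(\sum_iV_iTV_i^*\big)P_{K_0}=T$ (on $K_0$) are $T=\lambda I_{K_0}$, $\lambda\in\mathbb C$. $(V_i)$ is reversing on the random walk if $V_ie_{g_i(c)}=\overline{\nu_i(c)}e_c$ whenever $c\in M$ and $\nu_i(c)\ne0$. A nonempty word $\beta=\beta_0\cdots\beta_{p-1}$ is a cycle word for $c\in M$ if $g_\beta(c)=c$, $\nu_\beta(c)\neq0$ and $g_{\beta_k}\cdots g_{\beta_0}(c)\ne c$ for $0\le k<p-1$. A family $\{f_j\}_{j\in J}$ in a Hilbert space $K$ is a Parseval frame for $K$ if $\|v\|^2=\sum_j|\langle v,f_j\rangle|^2$ for all $v\in K$.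 *)

theory Defs
  imports "HOL-Analysis.Analysis"
begin

section \<open>Complex Hilbert spaces\<close>

text \<open>A complex inner product space is a real one whose real scalar multiplication and real inner
  product are induced by the complex ones. Positivity of \<^term>\<open>cinner\<close> and
  \<open>norm x = sqrt (Re (cinner x x))\<close> are inherited from \<^class>\<open>real_inner\<close>.
  The inner product is linear in its first argument.\<close>

class complex_inner = real_inner +
  fixes scaleC :: "complex \<Rightarrow> 'a \<Rightarrow> 'a"  (infixr \<open>*\<^sub>C\<close> 75)
    and cinner :: "'a \<Rightarrow> 'a \<Rightarrow> complex"
  assumes scaleC_add_right: "a *\<^sub>C (x + y) = a *\<^sub>C x + a *\<^sub>C y"
    and scaleC_add_left: "(a + b) *\<^sub>C x = a *\<^sub>C x + b *\<^sub>C x"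
    and scaleC_scaleC: "a *\<^sub>C (b *\<^sub>C x) = (a * b) *\<^sub>C x"
    and scaleC_one: "1 *\<^sub>C x = x"
    and scaleR_scaleC: "scaleR r x = complex_of_real r *\<^sub>C x"
    and cinner_commute: "cinner x y = cnj (cinner y x)"
    and cinner_add_left: "cinner (x + y) z = cinner x z + cinner y z"
    and cinner_scaleC_left: "cinner (a *\<^sub>C x) y = a * cinner x y"
    and inner_eq_Re_cinner: "inner x y = Re (cinner x y)"

class chilbert_space = complex_inner + complete_space

global_interpretation complex_vector:
  vector_space "scaleC :: complex \<Rightarrow> 'a \<Rightarrow> 'a :: complex_inner"
  defines csubspace = complex_vector.subspace
    and cspan = complex_vector.span
  by unfold_locales
    (simp_all add: scaleC_add_right scaleC_add_left scaleC_scaleC scaleC_one)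

text \<open>All Hilbert spaces of the development are closed subspaces of one ambient Hilbert space, so
  that inclusions between them are literal. An operator on a closed subspace is a function on the
  ambient type of which only the values on the subspace matter; every notion below ignores the
  other values, so a restricted operator is represented by the same function.\<close>

definition closed_csubspace :: "'h::complex_inner set \<Rightarrow> bool" where
  "closed_csubspace L \<longleftrightarrow> csubspace L \<and> closed L"

definition closed_span :: "'h::complex_inner set \<Rightarrow> 'h set" where
  "closed_span A = closure (cspan A)"

definition bounded_op_on :: "'h::complex_inner set \<Rightarrow> ('h \<Rightarrow> 'h) \<Rightarrow> bool" where
  "bounded_op_on L T \<longleftrightarrow>
     (\<forall>x\<in>L. T x \<in> L) \<and>
     (\<forall>x\<in>L. \<forall>y\<in>L. T (x + y) = T x + T y) \<and>
     (\<forall>a. \<forall>x\<in>L. T (a *\<^sub>C x) = a *\<^sub>C T x) \<and>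
     (\<exists>B. \<forall>x\<in>L. norm (T x) \<le> B * norm x)"

definition adj_on :: "'h::complex_inner set \<Rightarrow> ('h \<Rightarrow> 'h) \<Rightarrow> 'h \<Rightarrow> 'h" where
  "adj_on L T y = (THE z. z \<in> L \<and> (\<forall>x\<in>L. cinner (T x) y = cinner x z))"

definition proj_on :: "'h::complex_inner set \<Rightarrow> 'h \<Rightarrow> 'h" where
  "proj_on L v = (THE p. p \<in> L \<and> (\<forall>x\<in>L. cinner (v - p) x = 0))"

definition scalar_on :: "'h::complex_inner set \<Rightarrow> ('h \<Rightarrow> 'h) \<Rightarrow> bool" where
  "scalar_on L T \<longleftrightarrow> (\<exists>a. \<forall>x\<in>L. T x = a *\<^sub>C x)"

definition orthonormal_basis :: "'i set \<Rightarrow> ('i \<Rightarrow> 'h::complex_inner) \<Rightarrow> 'h set \<Rightarrow> bool" where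
  "orthonormal_basis J f L \<longleftrightarrow>
     (\<forall>i\<in>J. \<forall>j\<in>J. cinner (f i) (f j) = (if i = j then 1 else 0)) \<and>
     closed_span (f ` J) = L"

definition parseval_frame :: "'i set \<Rightarrow> ('i \<Rightarrow> 'h::complex_inner) \<Rightarrow> 'h set \<Rightarrow> bool" where
  "parseval_frame J f L \<longleftrightarrow>
     (\<forall>j\<in>J. f j \<in> L) \<and>
     (\<forall>v\<in>L. ((\<lambda>j. (cmod (cinner v (f j)))\<^sup>2) has_sum (norm v)\<^sup>2) J)"


section \<open>Row co-isometries and Cuntz dilations\<close>

definition words :: "nat \<Rightarrow> nat list set" where
  "words N = lists {..<N}"

fun word_op :: "(nat \<Rightarrow> 'h \<Rightarrow> 'h) \<Rightarrow> nat list \<Rightarrow> 'h \<Rightarrow> 'h" where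
  "word_op V [] x = x"
| "word_op V (i # w) x = V i (word_op V w x)"

definition row_coisometry ::
    "nat \<Rightarrow> 'h::complex_inner set \<Rightarrow> (nat \<Rightarrow> 'h \<Rightarrow> 'h) \<Rightarrow> bool" where
  "row_coisometry N K V \<longleftrightarrow>
     closed_csubspace K \<and>
     (\<forall>i<N. bounded_op_on K (V i)) \<and>
     (\<forall>x\<in>K. (\<Sum>i<N. V i (adj_on K (V i) x)) = x)"

definition cuntz_rep ::
    "nat \<Rightarrow> 'h::complex_inner set \<Rightarrow> (nat \<Rightarrow> 'h \<Rightarrow> 'h) \<Rightarrow> bool" where
  "cuntz_rep N H S \<longleftrightarrow>
     closed_csubspace H \<and>
     (\<forall>i<N. bounded_op_on H (S i)) \<and>
     (\<forall>x\<in>H. (\<Sum>i<N. S i (adj_on H (S i) x)) = x) \<and>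
     (\<forall>i<N. \<forall>j<N. \<forall>x\<in>H. adj_on H (S j) (S i x) = (if i = j then x else 0))"

definition irreducible_rep ::
    "nat \<Rightarrow> 'h::complex_inner set \<Rightarrow> (nat \<Rightarrow> 'h \<Rightarrow> 'h) \<Rightarrow> bool" where
  "irreducible_rep N H S \<longleftrightarrow>
     (\<forall>T. bounded_op_on H T \<and>
          (\<forall>i<N. \<forall>x\<in>H. T (S i x) = S i (T x) \<and> T (adj_on H (S i) x) = adj_on H (S i) (T x))
          \<longrightarrow> scalar_on H T)"

text \<open>Monomials in the \<open>S\<^sub>i\<close> and \<open>S\<^sub>i\<^sup>*\<close>; a letter \<open>(i, True)\<close> stands for \<open>S\<^sub>i\<^sup>*\<close>. They span the
  unital *-algebra generated by the \<open>S\<^sub>i\<close>, which is dense in the image of the Cuntz algebra.\<close>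

fun star_word_op ::
    "'h::complex_inner set \<Rightarrow> (nat \<Rightarrow> 'h \<Rightarrow> 'h) \<Rightarrow> (nat \<times> bool) list \<Rightarrow> 'h \<Rightarrow> 'h" where
  "star_word_op H S [] x = x"
| "star_word_op H S ((i, b) # w) x =
     (if b then adj_on H (S i) else S i) (star_word_op H S w x)"

definition cyclic_for ::
    "nat \<Rightarrow> 'h::complex_inner set \<Rightarrow> (nat \<Rightarrow> 'h \<Rightarrow> 'h) \<Rightarrow> 'h set \<Rightarrow> bool" where
  "cyclic_for N H S K \<longleftrightarrow>
     closed_span {star_word_op H S w x | w x. w \<in> lists ({..<N} \<times> UNIV) \<and> x \<in> K} = H"

definition cuntz_dilation ::
    "nat \<Rightarrow> 'h::complex_inner set \<Rightarrow> (nat \<Rightarrow> 'h \<Rightarrow> 'h) \<Rightarrow> 'h set \<Rightarrow> (nat \<Rightarrow> 'h \<Rightarrow> 'h) \<Rightarrow> bool" where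
  "cuntz_dilation N K V H S \<longleftrightarrow>
     row_coisometry N K V \<and> cuntz_rep N H S \<and> K \<subseteq> H \<and> cyclic_for N H S K \<and>
     (\<forall>i<N. \<forall>x\<in>K. adj_on H (S i) x \<in> K \<and> adj_on K (V i) x = adj_on H (S i) x)"


section \<open>Random walks\<close>

text \<open>The first letter of a word is the first step of the walk.\<close>

fun walk_pt :: "(nat \<Rightarrow> 'm \<Rightarrow> 'm) \<Rightarrow> nat list \<Rightarrow> 'm \<Rightarrow> 'm" where
  "walk_pt g [] c = c"
| "walk_pt g (i # w) c = walk_pt g w (g i c)"

fun walk_wt :: "(nat \<Rightarrow> 'm \<Rightarrow> 'm) \<Rightarrow> (nat \<Rightarrow> 'm \<Rightarrow> complex) \<Rightarrow> nat list \<Rightarrow> 'm \<Rightarrow> complex" where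
  "walk_wt g \<nu> [] c = 1"
| "walk_wt g \<nu> (i # w) c = \<nu> i c * walk_wt g \<nu> w (g i c)"

definition acts_as_random_walk ::
    "nat \<Rightarrow> 'h::complex_inner set \<Rightarrow> (nat \<Rightarrow> 'h \<Rightarrow> 'h) \<Rightarrow> 'h set \<Rightarrow>
     'm set \<Rightarrow> (nat \<Rightarrow> 'm \<Rightarrow> 'm) \<Rightarrow> (nat \<Rightarrow> 'm \<Rightarrow> complex) \<Rightarrow> ('m \<Rightarrow> 'h) \<Rightarrow> bool" where
  "acts_as_random_walk N K V K0 M g \<nu> e \<longleftrightarrow>
     (\<forall>i<N. \<forall>x\<in>K0. adj_on K (V i) x \<in> K0) \<and>
     finite M \<and> orthonormal_basis M e K0 \<and>
     (\<forall>i<N. \<forall>c\<in>M. g i c \<in> M \<and> adj_on K (V i) (e c) = \<nu> i c *\<^sub>C e (g i c)) \<and>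
     (\<forall>i<N. \<forall>c1\<in>M. \<forall>c2\<in>M. \<nu> i c1 \<noteq> 0 \<and> \<nu> i c2 \<noteq> 0 \<and> g i c1 = g i c2 \<longrightarrow> c1 = c2)"

definition irreducible_walk ::
    "nat \<Rightarrow> 'm set \<Rightarrow> (nat \<Rightarrow> 'm \<Rightarrow> 'm) \<Rightarrow> (nat \<Rightarrow> 'm \<Rightarrow> complex) \<Rightarrow> bool" where
  "irreducible_walk N M g \<nu> \<longleftrightarrow>
     (\<forall>c1\<in>M. \<forall>c2\<in>M. \<exists>w\<in>words N. walk_pt g w c1 = c2 \<and> walk_wt g \<nu> w c1 \<noteq> 0)"

definition simple_on ::
    "nat \<Rightarrow> 'h::complex_inner set \<Rightarrow> (nat \<Rightarrow> 'h \<Rightarrow> 'h) \<Rightarrow> 'h set \<Rightarrow> bool" where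
  "simple_on N K V K0 \<longleftrightarrow>
     (\<forall>T. bounded_op_on K0 T \<and>
          (\<forall>x\<in>K0. proj_on K0 (\<Sum>i<N. V i (T (adj_on K (V i) (proj_on K0 x)))) = T x)
          \<longrightarrow> scalar_on K0 T)"

definition reversing ::
    "nat \<Rightarrow> (nat \<Rightarrow> 'h::complex_inner \<Rightarrow> 'h) \<Rightarrow>
     'm set \<Rightarrow> (nat \<Rightarrow> 'm \<Rightarrow> 'm) \<Rightarrow> (nat \<Rightarrow> 'm \<Rightarrow> complex) \<Rightarrow> ('m \<Rightarrow> 'h) \<Rightarrow> bool" where
  "reversing N V M g \<nu> e \<longleftrightarrow>
     (\<forall>i<N. \<forall>c\<in>M. \<nu> i c \<noteq> 0 \<longrightarrow> V i (e (g i c)) = cnj (\<nu> i c) *\<^sub>C e c)"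

definition cycle_word ::
    "nat \<Rightarrow> (nat \<Rightarrow> 'm \<Rightarrow> 'm) \<Rightarrow> (nat \<Rightarrow> 'm \<Rightarrow> complex) \<Rightarrow> 'm \<Rightarrow> nat list \<Rightarrow> bool" where
  "cycle_word N g \<nu> c \<beta> \<longleftrightarrow>
     \<beta> \<in> words N \<and> \<beta> \<noteq> [] \<and> walk_pt g \<beta> c = c \<and> walk_wt g \<nu> \<beta> c \<noteq> 0 \<and>
     (\<forall>k. k + 1 < length \<beta> \<longrightarrow> walk_pt g (take (k + 1) \<beta>) c \<noteq> c)"

definition cycle_free_words ::
    "nat \<Rightarrow> (nat \<Rightarrow> 'm \<Rightarrow> 'm) \<Rightarrow> (nat \<Rightarrow> 'm \<Rightarrow> complex) \<Rightarrow> 'm \<Rightarrow> nat list set" where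
  "cycle_free_words N g \<nu> c = {w \<in> words N. \<not> (\<exists>w' \<beta>. cycle_word N g \<nu> c \<beta> \<and> w = w' @ \<beta>)}"

text \<open>\<open>\<Omega>\<^sub>c\<^sup>(\<^sup>n\<^sup>)\<close>; for \<open>n = 0\<close> these are the words that do not end in a cycle word.\<close>

definition cycle_ending_words ::
    "nat \<Rightarrow> (nat \<Rightarrow> 'm \<Rightarrow> 'm) \<Rightarrow> (nat \<Rightarrow> 'm \<Rightarrow> complex) \<Rightarrow> 'm \<Rightarrow> nat \<Rightarrow> nat list set" where
  "cycle_ending_words N g \<nu> c n =
     {w @ concat \<beta>s | w \<beta>s.
        w \<in> cycle_free_words N g \<nu> c \<and> length \<beta>s = n \<and> (\<forall>\<beta>\<in>set \<beta>s. cycle_word N g \<nu> c \<beta>)}"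

end

theory Submission
  imports Defs
begin

text \<open>Since \<open>S\<^sub>w\<^sup>* e\<^sub>c\<close> is a multiple of a basis vector, \<open>S\<^sub>v e\<^sub>c\<close> and \<open>S\<^sub>w e\<^sub>c\<close> can fail to be orthogonal
  only if one word is the other followed by a loop at \<open>c\<close>. Loops factor into cycle words, and by
  injectivity of the steps the cycle words form a suffix code; so distinct words of the same
  \<open>\<Omega>\<^sub>c\<^sup>(\<^sup>n\<^sup>)\<close> give orthogonal vectors. Recurrence of the finite irreducible walk says that \<open>e\<^sub>c\<close> lies in
  the closed span of the \<open>S\<^sub>\<beta> e\<^sub>c\<close>, \<open>\<beta>\<close> a cycle word, whence \<open>H\<^sub>c\<^sup>(\<^sup>n\<^sup>)\<close> increases with \<open>n\<close>.

  Irreducibility is governed by the compression \<open>T \<mapsto> P\<^sub>K T\<close>, which maps the commutant of a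
  Cuntz dilation onto the fixed points of \<open>T \<mapsto> \<Sum> V\<^sub>i T V\<^sub>i\<^sup>*\<close> and is injective. It is applied to both
  \<open>K\<close> and \<open>K\<^sub>0\<close>.

  In the reversing case \<open>V\<^sub>\<beta> e\<^sub>c\<close> is a multiple of \<open>e\<^sub>c\<close> for every cycle word \<open>\<beta>\<close>, so the vectors of
  \<open>K\<close> do not see the difference between \<open>H\<^sub>c\<^sup>(\<^sup>n\<^sup>)\<close> and \<open>H\<^sub>c\<^sup>(\<^sup>n\<^sup>+\<^sup>1\<^sup>)\<close>.\<close>

section \<open>Complex inner product spaces\<close>

lemma cinner_add_right: "cinner x (y + z) = cinner x y + cinner x (z::'h::complex_inner)"
  by (metis cinner_add_left cinner_commute complex_cnj_add)

lemma cinner_scaleC_right: "cinner x (a *\<^sub>C y) = cnj a * cinner x (y::'h::complex_inner)"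
  by (metis cinner_commute cinner_scaleC_left complex_cnj_mult)

lemma cinner_self: "cinner x x = complex_of_real ((norm (x::'h::complex_inner))\<^sup>2)"
proof (rule complex_eqI)
  show "Re (cinner x x) = Re (complex_of_real ((norm x)\<^sup>2))"
    by (simp add: power2_norm_eq_inner inner_eq_Re_cinner)
  show "Im (cinner x x) = Im (complex_of_real ((norm x)\<^sup>2))"
    using arg_cong[OF cinner_commute[of x x], of Im] by simp
qed

lemma norm_scaleC: "norm (a *\<^sub>C x) = cmod a * norm (x::'h::complex_inner)"
proof -
  have "complex_of_real ((norm (a *\<^sub>C x))\<^sup>2) = a * cnj a * cinner x x"
    by (simp only: cinner_self[symmetric] cinner_scaleC_left cinner_scaleC_right mult.assoc mult.left_commute)
  also have "\<dots> = complex_of_real ((cmod a * norm x)\<^sup>2)"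
    by (simp only: cinner_self complex_norm_square[symmetric] power_mult_distrib of_real_mult of_real_power)
  finally show ?thesis
    unfolding of_real_eq_iff by (rule power2_eq_imp_eq) simp_all
qed

lemma cmod_cinner_le: "cmod (cinner x y) \<le> norm x * norm (y::'h::complex_inner)"
proof (cases "cinner x y = 0")
  case False
  \<comment> \<open>The phase that makes \<open>cinner (a *\<^sub>C x) y\<close> real and
    nonnegative, so that the real Cauchy-Schwarz inequality loses nothing.\<close>
  define a where "a = cnj (sgn (cinner x y))"
  have a: "cmod a = 1"
    using False by (simp add: a_def norm_sgn)
  have "a * cinner x y = complex_of_real (cmod (cinner x y))"
    using False unfolding a_def sgn_eq
    by (simp add: complex_norm_square[symmetric] power2_eq_square mult.commute)
  then have "cmod (cinner x y) = inner (a *\<^sub>C x) y"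
    by (simp add: inner_eq_Re_cinner cinner_scaleC_left)
  also have "\<dots> \<le> norm (a *\<^sub>C x) * norm y"
    by (rule norm_cauchy_schwarz)
  finally show ?thesis
    by (simp add: norm_scaleC a)
qed simp

text \<open>Conjugation is real linear, so over the reals both arguments are linear. This supplies
  continuity and the rules for sums and differences.\<close>

interpretation cinner: bounded_bilinear "cinner :: 'h::complex_inner \<Rightarrow> 'h \<Rightarrow> complex"
proof
  show "\<exists>B. \<forall>x y::'h. cmod (cinner x y) \<le> norm x * norm y * B"
    by (rule exI[of _ 1]) (simp add: cmod_cinner_le)
qed (simp_all add: cinner_add_left cinner_add_right scaleR_scaleC cinner_scaleC_left
    cinner_scaleC_right scaleR_conv_of_real)

interpretation scaleC: bounded_bilinear "scaleC :: complex \<Rightarrow> 'h::complex_inner \<Rightarrow> 'h"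
proof
  show "\<exists>B. \<forall>a. \<forall>x::'h. norm (a *\<^sub>C x) \<le> cmod a * norm x * B"
    by (rule exI[of _ 1]) (simp add: norm_scaleC)
qed (simp_all add: scaleC_add_left scaleC_add_right scaleR_scaleC scaleC_scaleC
    scaleR_conv_of_real mult.commute)

lemma cinner_eq_0_commute: "cinner x y = 0 \<longleftrightarrow> cinner y (x::'h::complex_inner) = 0"
  by (metis cinner_commute complex_cnj_zero)

lemma cmod_cinner_commute: "cmod (cinner x y) = cmod (cinner y (x::'h::complex_inner))"
  by (metis cinner_commute complex_mod_cnj)

lemma cinner_self_eq_0 [simp]: "cinner x x = 0 \<longleftrightarrow> (x::'h::complex_inner) = 0"
  by (simp add: cinner_self)

lemma norm_add_sq_orth:
  "cinner x y = 0 \<Longrightarrow> (norm (x + y::'h::complex_inner))\<^sup>2 = (norm x)\<^sup>2 + (norm y)\<^sup>2"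
  using cinner_eq_0_commute[of x y]
  by (simp add: power2_norm_eq_inner inner_eq_Re_cinner cinner_add_left cinner_add_right)

lemma norm_sq_sum_orth:
  assumes "finite F" "\<And>i j. i \<in> F \<Longrightarrow> j \<in> F \<Longrightarrow> i \<noteq> j \<Longrightarrow> cinner (f i) (f j) = 0"
  shows "(norm (\<Sum>i\<in>F. f i :: 'h::complex_inner))\<^sup>2 = (\<Sum>i\<in>F. (norm (f i))\<^sup>2)"
  using assms
proof (induction F rule: finite_induct)
  case (insert i F)
  have "cinner (f i) (\<Sum>i\<in>F. f i) = 0"
    using insert by (auto simp: cinner.sum_right intro!: sum.neutral)
  then show ?case
    using insert by (simp add: norm_add_sq_orth)
qed simp


section \<open>Closed subspaces\<close>

lemma closed_csubspaceD:
  assumes "closed_csubspace (L::'h::complex_inner set)"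
  shows "0 \<in> L" and "x \<in> L \<Longrightarrow> y \<in> L \<Longrightarrow> x + y \<in> L" and "x \<in> L \<Longrightarrow> a *\<^sub>C x \<in> L"
    and "x \<in> L \<Longrightarrow> y \<in> L \<Longrightarrow> x - y \<in> L" and "x \<in> L \<Longrightarrow> r *\<^sub>R x \<in> L"
    and "(\<And>i. i \<in> F \<Longrightarrow> f i \<in> L) \<Longrightarrow> sum f F \<in> L"
  using assms unfolding closed_csubspace_def
  by (auto intro: complex_vector.subspace_0 complex_vector.subspace_add
      complex_vector.subspace_scale complex_vector.subspace_diff complex_vector.subspace_sum
      simp: scaleR_scaleC)

lemma closed_csubspaceI:
  assumes "0 \<in> L" "\<And>x y. x \<in> L \<Longrightarrow> y \<in> L \<Longrightarrow> x + y \<in> L" "\<And>a x. x \<in> L \<Longrightarrow> a *\<^sub>C x \<in> L"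
    and "\<And>f l. (\<And>n::nat. f n \<in> L) \<Longrightarrow> f \<longlonglongrightarrow> l \<Longrightarrow> l \<in> L"
  shows "closed_csubspace (L::'h::complex_inner set)"
  using assms unfolding closed_csubspace_def complex_vector.subspace_def closed_sequential_limits
  by blast

lemma closed_csubspace_limit:
  assumes "closed_csubspace (L::'h::complex_inner set)" "\<And>n::nat. f n \<in> L" "f \<longlonglongrightarrow> l"
  shows "l \<in> L"
  using assms closed_sequentially unfolding closed_csubspace_def by blast

lemma closed_csubspace_closure:
  assumes L: "csubspace (L::'h::complex_inner set)"
  shows "closed_csubspace (closure L)"
proof -
  have "csubspace (closure L)"
    unfolding complex_vector.subspace_def
  proof (intro conjI ballI allI)
    show "0 \<in> closure L"
      using closure_subset complex_vector.subspace_0[OF L] by blast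
    fix x a assume "x \<in> closure L"
    then obtain f where f: "\<And>n. f n \<in> L" "f \<longlonglongrightarrow> x"
      by (auto simp: closure_sequential)
    have "(\<lambda>n. a *\<^sub>C f n) \<longlonglongrightarrow> a *\<^sub>C x"
      by (intro tendsto_intros scaleC.tendsto f)
    then show "a *\<^sub>C x \<in> closure L"
      using f(1) complex_vector.subspace_scale[OF L] unfolding closure_sequential
      by (intro exI[of _ "\<lambda>n. a *\<^sub>C f n"]) simp
    fix y assume "y \<in> closure L"
    then obtain h where h: "\<And>n. h n \<in> L" "h \<longlonglongrightarrow> y"
      by (auto simp: closure_sequential)
    have "(\<lambda>n. f n + h n) \<longlonglongrightarrow> x + y"
      by (intro tendsto_intros f h)
    then show "x + y \<in> closure L"
      using f(1) h(1) complex_vector.subspace_add[OF L] unfolding closure_sequential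
      by (intro exI[of _ "\<lambda>n. f n + h n"]) simp
  qed
  then show ?thesis
    by (simp add: closed_csubspace_def)
qed

lemma closed_csubspace_closed_span [simp]: "closed_csubspace (closed_span A)"
  unfolding closed_span_def by (intro closed_csubspace_closure complex_vector.subspace_span)

lemma closed_span_superset: "A \<subseteq> closed_span A"
  unfolding closed_span_def using closure_subset complex_vector.span_superset by blast

lemma closed_span_base: "x \<in> A \<Longrightarrow> x \<in> closed_span A"
  using closed_span_superset by blast

lemma closed_span_minimal: "A \<subseteq> L \<Longrightarrow> closed_csubspace L \<Longrightarrow> closed_span A \<subseteq> L"
  unfolding closed_span_def closed_csubspace_def
  by (intro closure_minimal complex_vector.span_minimal) auto

lemma closed_span_mono: "A \<subseteq> closed_span B \<Longrightarrow> closed_span A \<subseteq> closed_span B"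
  by (rule closed_span_minimal) simp_all

lemma closed_csubspace_orth:
  "closed_csubspace {x::'h::complex_inner. \<forall>y\<in>A. cinner y x = 0}"
proof (rule closed_csubspaceI)
  fix f l assume f: "\<And>n::nat. f n \<in> {x. \<forall>y\<in>A. cinner y x = 0}" and l: "f \<longlonglongrightarrow> l"
  show "l \<in> {x. \<forall>y\<in>A. cinner y x = 0}"
  proof (clarify)
    fix y assume "y \<in> A"
    then have "(\<lambda>n. cinner y (f n)) = (\<lambda>n. 0)"
      using f by auto
    moreover have "(\<lambda>n. cinner y (f n)) \<longlonglongrightarrow> cinner y l"
      by (intro cinner.tendsto tendsto_const l)
    ultimately show "cinner y l = 0"
      by (simp add: LIMSEQ_const_iff)
  qed
qed (auto simp: cinner_add_right cinner_scaleC_right cinner.zero_right)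

text \<open>The vectors orthogonal to \<open>y\<close> form a closed subspace, so it is enough to
  test generators.\<close>

lemma orth_closed_span:
  assumes "x \<in> closed_span A" "\<And>z. z \<in> A \<Longrightarrow> cinner y z = 0"
  shows "cinner y (x::'h::complex_inner) = 0"
proof -
  have "closed_span A \<subseteq> {x. \<forall>y\<in>{y}. cinner y x = 0}"
    using assms(2) by (intro closed_span_minimal closed_csubspace_orth) auto
  then show ?thesis using assms(1) by auto
qed


lemma closed_csubspace_zero: "closed_csubspace {0}"
  by (simp add: closed_csubspace_def complex_vector.subspace_single_0)

lemma eq_if_cinner_eq:
  assumes "closed_csubspace L" "x \<in> L" "y \<in> L" "\<And>z. z \<in> L \<Longrightarrow> cinner x z = cinner y z"
  shows "x = (y::'h::complex_inner)"
proof -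
  have "cinner (x - y) (x - y) = 0"
    using assms(4)[OF closed_csubspaceD(4)[OF assms(1-3)]] by (simp only: cinner.diff_left) simp
  then show ?thesis by simp
qed


section \<open>Bounded operators on closed subspaces\<close>

lemma bounded_op_onD:
  assumes "bounded_op_on L T"
  shows "x \<in> L \<Longrightarrow> T x \<in> L" and "x \<in> L \<Longrightarrow> y \<in> L \<Longrightarrow> T (x + y) = T x + T y"
    and "x \<in> L \<Longrightarrow> T (a *\<^sub>C x) = a *\<^sub>C T x"
  using assms unfolding bounded_op_on_def by blast+

lemma bounded_op_on_bound:
  assumes "bounded_op_on L T"
  obtains B where "B \<ge> 0" "\<And>x. x \<in> L \<Longrightarrow> norm (T x) \<le> B * norm x"
proof -
  obtain B where B: "\<And>x. x \<in> L \<Longrightarrow> norm (T x) \<le> B * norm x"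
    using assms unfolding bounded_op_on_def by blast
  have "norm (T x) \<le> max B 0 * norm x" if "x \<in> L" for x
    using B[OF that] mult_right_mono[of B "max B 0" "norm x"] by simp
  then show ?thesis
    using that[of "max B 0"] by simp
qed

lemma bounded_op_on_0: "bounded_op_on L T \<Longrightarrow> closed_csubspace L \<Longrightarrow> T 0 = 0"
  using bounded_op_onD(3)[of L T 0 0] closed_csubspaceD(1)[of L] by simp

lemma bounded_op_on_diff:
  "bounded_op_on L T \<Longrightarrow> closed_csubspace L \<Longrightarrow> x \<in> L \<Longrightarrow> y \<in> L \<Longrightarrow> T (x - y) = T x - T y"
  using bounded_op_onD(2)[of L T "x - y" y] closed_csubspaceD(4)[of L x y] by simp

lemma bounded_op_on_sum:
  assumes T: "bounded_op_on L T" "closed_csubspace L" and "\<And>i. i \<in> F \<Longrightarrow> f i \<in> L"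
  shows "T (\<Sum>i\<in>F. f i) = (\<Sum>i\<in>F. T (f i))"
  using assms(3)
proof (induction F rule: infinite_finite_induct)
  case (insert i F)
  then show ?case
    using bounded_op_onD(2)[OF T(1), of "f i" "sum f F"] closed_csubspaceD(6)[OF T(2), of F f]
    by simp
qed (simp_all add: bounded_op_on_0[OF T])

lemma bounded_op_on_tendsto:
  assumes T: "bounded_op_on L T" and L: "closed_csubspace L"
    and f: "\<And>n. f n \<in> L" "f \<longlonglongrightarrow> l" and l: "l \<in> L"
  shows "(\<lambda>n. T (f n)) \<longlonglongrightarrow> T l"
proof -
  obtain B where B: "\<And>x. x \<in> L \<Longrightarrow> norm (T x) \<le> B * norm x"
    using bounded_op_on_bound[OF T] by metis
  have le: "norm (T (f n) - T l) \<le> B * norm (f n - l)" for n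
    using B[of "f n - l"] closed_csubspaceD(4)[OF L] f(1) l
    by (simp add: bounded_op_on_diff[OF T L])
  have "(\<lambda>n. B * norm (f n - l)) \<longlonglongrightarrow> 0"
    using tendsto_mult[OF tendsto_const[of B] tendsto_norm_zero[OF Lim_null[THEN iffD1, OF f(2)]]]
    by simp
  then have "(\<lambda>n. T (f n) - T l) \<longlonglongrightarrow> 0"
    by (rule Lim_null_comparison[OF always_eventually[OF allI[OF le]]])
  then show ?thesis
    by (rule LIM_zero_cancel)
qed

lemma closed_csubspace_vimage:
  assumes T: "bounded_op_on L T" and L: "closed_csubspace L" and "closed_csubspace L'"
  shows "closed_csubspace {x \<in> L. T x \<in> L'}"
proof (rule closed_csubspaceI)
  fix f l assume "\<And>n::nat. f n \<in> {x \<in> L. T x \<in> L'}" and l: "f \<longlonglongrightarrow> l"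
  then have f: "\<And>n. f n \<in> L" "\<And>n. T (f n) \<in> L'" by auto
  have "l \<in> L"
    using closed_csubspace_limit[OF L f(1) l] .
  moreover have "T l \<in> L'"
    using closed_csubspace_limit[OF assms(3) f(2) bounded_op_on_tendsto[OF T L f(1) l \<open>l \<in> L\<close>]] .
  ultimately show "l \<in> {x \<in> L. T x \<in> L'}" by simp
qed (use assms in \<open>auto simp: closed_csubspaceD bounded_op_on_0 bounded_op_onD\<close>)

text \<open>The preimage of a closed subspace under a bounded operator is a closed subspace, hence
  contains a closed span as soon as it contains the generators.\<close>

lemma bounded_op_on_closed_span:
  assumes "bounded_op_on L T" "closed_csubspace L" "closed_csubspace L'"
    and "\<And>x. x \<in> A \<Longrightarrow> x \<in> L \<and> T x \<in> L'" and "x \<in> closed_span A"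
  shows "T x \<in> L'"
  using closed_span_minimal[OF _ closed_csubspace_vimage[OF assms(1-3)], of A] assms(4,5) by blast


lemma bounded_op_on_diff_scaleC:
  assumes T: "bounded_op_on L T" and L: "closed_csubspace L"
  shows "bounded_op_on L (\<lambda>x. T x - a *\<^sub>C x)"
proof -
  obtain B where B: "\<And>x. x \<in> L \<Longrightarrow> norm (T x) \<le> B * norm x"
    using bounded_op_on_bound[OF T] by metis
  have "norm (T x - a *\<^sub>C x) \<le> (B + cmod a) * norm x" if "x \<in> L" for x
    using norm_triangle_ineq4[of "T x" "a *\<^sub>C x"] B[OF that] by (simp add: norm_scaleC algebra_simps)
  then show ?thesis
    using bounded_op_onD[OF T] closed_csubspaceD(3,4)[OF L] unfolding bounded_op_on_def
    by (auto simp: scaleC_add_right scaleC.diff_right scaleC_scaleC mult.commute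
        intro!: exI[of _ "B + cmod a"])
qed

lemma bounded_op_on_subset:
  "bounded_op_on L T \<Longrightarrow> L' \<subseteq> L \<Longrightarrow> (\<And>x. x \<in> L' \<Longrightarrow> T x \<in> L') \<Longrightarrow> bounded_op_on L' T"
  unfolding bounded_op_on_def by blast


section \<open>Orthogonal projections and adjoints\<close>

text \<open>A minimizing sequence is Cauchy by the parallelogram law, because the midpoint of two of
  its members is again at distance at least \<open>\<delta>\<close> from \<open>v\<close>.
  Completeness gives the limit.\<close>

lemma ex_closest_point:
  fixes v :: "'h::chilbert_space"
  assumes L: "closed_csubspace L"
  shows "\<exists>p\<in>L. \<forall>x\<in>L. norm (v - p) \<le> norm (v - x)"
proof -
  have ne: "L \<noteq> {}" using closed_csubspaceD(1)[OF L] by blast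
  define \<delta> where "\<delta> = infdist v L"
  have \<delta>: "\<delta> \<le> norm (v - x)" if "x \<in> L" for x
    unfolding \<delta>_def using infdist_le[OF that, of v] by (simp add: dist_norm)
  have \<delta>0: "\<delta> \<ge> 0"
    by (simp add: \<delta>_def infdist_nonneg)
  have "\<exists>x\<in>L. norm (v - x) < \<delta> + 1 / Suc n" for n
  proof (rule ccontr)
    assume *: "\<not> ?thesis"
    have "\<delta> + 1 / Suc n \<le> infdist v L"
      unfolding infdist_notempty[OF ne] using *
      by (intro cINF_greatest[OF ne]) (auto simp: dist_norm not_less)
    then show False
      by (simp add: \<delta>_def[symmetric] field_simps)
  qed
  then obtain f where f: "\<And>n. f n \<in> L" "\<And>n. norm (v - f n) < \<delta> + 1 / Suc n"
    by metis
  have lim: "(\<lambda>n. norm (v - f n)) \<longlonglongrightarrow> \<delta>"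
  proof (rule tendsto_sandwich[OF _ _ tendsto_const])
    show "(\<lambda>n. \<delta> + 1 / Suc n) \<longlonglongrightarrow> \<delta>"
      using tendsto_add[OF tendsto_const[of \<delta>] lim_1_over_n[THEN LIMSEQ_Suc]] by simp
  qed (use \<delta>[OF f(1)] f(2) in \<open>auto simp: less_imp_le\<close>)
  have par: "(norm (f m - f n))\<^sup>2 \<le> 2 * (norm (v - f m))\<^sup>2 + 2 * (norm (v - f n))\<^sup>2 - 4 * \<delta>\<^sup>2" for m n
  proof -
    define h where "h = (1/2) *\<^sub>R (f m + f n)"
    have "h \<in> L" unfolding h_def by (intro closed_csubspaceD[OF L] f)
    then have "\<delta>\<^sup>2 \<le> (norm (v - h))\<^sup>2"
      using \<delta>[of h] \<delta>0 by (simp add: power_mono)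
    moreover have "(norm (f m - f n))\<^sup>2 + 4 * (norm (v - h))\<^sup>2
        = 2 * (norm (v - f m))\<^sup>2 + 2 * (norm (v - f n))\<^sup>2"
      unfolding h_def power2_norm_eq_inner
      by (simp add: inner_diff inner_add inner_commute algebra_simps)
    ultimately show ?thesis by linarith
  qed
  have "Cauchy f"
  proof (rule metric_CauchyI)
    fix \<epsilon> :: real assume "\<epsilon> > 0"
    have "(\<lambda>n. (norm (v - f n))\<^sup>2) \<longlonglongrightarrow> \<delta>\<^sup>2"
      by (intro tendsto_intros lim)
    then obtain n0 where n0: "\<And>n. n \<ge> n0 \<Longrightarrow> \<bar>(norm (v - f n))\<^sup>2 - \<delta>\<^sup>2\<bar> < \<epsilon>\<^sup>2 / 4"
      using \<open>\<epsilon> > 0\<close> by (metis LIMSEQ_iff real_norm_def zero_less_divide_iff zero_less_numeral zero_less_power)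
    have "dist (f m) (f n) < \<epsilon>" if "m \<ge> n0" "n \<ge> n0" for m n
    proof -
      have "(norm (f m - f n))\<^sup>2 < \<epsilon>\<^sup>2"
        using par[of m n] n0[OF that(1)] n0[OF that(2)] by linarith
      then show ?thesis
        using \<open>\<epsilon> > 0\<close> by (simp add: dist_norm power_less_imp_less_base)
    qed
    then show "\<exists>M. \<forall>m\<ge>M. \<forall>n\<ge>M. dist (f m) (f n) < \<epsilon>" by blast
  qed
  then obtain p where p: "f \<longlonglongrightarrow> p"
    using Cauchy_convergent convergent_def by blast
  have "(\<lambda>n. norm (v - f n)) \<longlonglongrightarrow> norm (v - p)"
    by (intro tendsto_intros p)
  then have "norm (v - p) = \<delta>"
    using lim LIMSEQ_unique by blast
  then show ?thesis
    using closed_csubspace_limit[OF L f(1) p] \<delta> by auto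
qed

lemma ex_orth_projection:
  fixes v :: "'h::chilbert_space"
  assumes L: "closed_csubspace L"
  shows "\<exists>p\<in>L. \<forall>x\<in>L. cinner (v - p) x = 0"
proof -
  obtain p where p: "p \<in> L" "\<And>x. x \<in> L \<Longrightarrow> norm (v - p) \<le> norm (v - x)"
    using ex_closest_point[OF L] by blast
  have real: "inner (v - p) x = 0" if x: "x \<in> L" for x
  proof (rule ccontr)
    assume nz: "inner (v - p) x \<noteq> 0"
    then have x0: "inner x x > 0" by (cases "x = 0") auto
    \<comment> \<open>The parameter minimizing the distance from \<open>v\<close> to
      \<open>p + t *\<^sub>R x\<close>; the minimum would lie below the distance at
      \<open>p\<close>.\<close>
    define t where "t = inner (v - p) x / inner x x"
    have "(norm (v - p))\<^sup>2 \<le> (norm (v - (p + t *\<^sub>R x)))\<^sup>2"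
      by (intro power_mono p(2) closed_csubspaceD[OF L] p(1) x) simp
    also have "\<dots> = (norm (v - p))\<^sup>2 - 2 * t * inner (v - p) x + t\<^sup>2 * inner x x"
      unfolding power2_norm_eq_inner
      by (simp add: inner_diff inner_add inner_commute algebra_simps power2_eq_square)
    also have "\<dots> = (norm (v - p))\<^sup>2 - (inner (v - p) x)\<^sup>2 / inner x x"
      using x0 by (simp add: t_def power2_eq_square field_simps)
    finally show False
      using nz x0 by (simp add: divide_le_0_iff)
  qed
  \<comment> \<open>The real inner product with \<open>\<i> *\<^sub>C x\<close> is the imaginary
    part of the complex one with \<open>x\<close>.\<close>
  have "cinner (v - p) x = 0" if x: "x \<in> L" for x
    using real[OF x] real[OF closed_csubspaceD(3)[OF L x, of \<i>]]
    by (simp add: inner_eq_Re_cinner cinner_scaleC_right complex_eq_iff)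
  then show ?thesis using p(1) by blast
qed

text \<open>Two candidates differ by a vector of \<open>L\<close> orthogonal to \<open>L\<close>.
  Projections are computed below by exhibiting a candidate and applying this rule.\<close>

lemma proj_on_eqI:
  fixes v :: "'h::complex_inner"
  assumes L: "closed_csubspace L" and p: "p \<in> L" "\<And>x. x \<in> L \<Longrightarrow> cinner (v - p) x = 0"
  shows "proj_on L v = p"
  unfolding proj_on_def
proof (rule the_equality)
  fix q assume q: "q \<in> L \<and> (\<forall>x\<in>L. cinner (v - q) x = 0)"
  have "p - q \<in> L" using closed_csubspaceD[OF L] p(1) q by blast
  then have "cinner ((v - q) - (v - p)) (p - q) = 0"
    using p(2) q by (simp only: cinner.diff_left) simp
  then show "q = p" by simp
qed (use p in auto)

lemma proj_on:
  fixes v :: "'h::chilbert_space"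
  assumes L: "closed_csubspace L"
  shows proj_on_in: "proj_on L v \<in> L" and proj_on_orth: "x \<in> L \<Longrightarrow> cinner (v - proj_on L v) x = 0"
proof -
  obtain p where "p \<in> L" "\<forall>x\<in>L. cinner (v - p) x = 0"
    using ex_orth_projection[OF L] by blast
  moreover from this have "proj_on L v = p" using proj_on_eqI[OF L] by blast
  ultimately show "proj_on L v \<in> L" "x \<in> L \<Longrightarrow> cinner (v - proj_on L v) x = 0" by auto
qed

lemma cinner_proj_on:
  "closed_csubspace L \<Longrightarrow> x \<in> L \<Longrightarrow> cinner (proj_on L v) x = cinner (v::'h::chilbert_space) x"
  using proj_on_orth[of L x v] by (simp add: cinner.diff_left)

lemma proj_on_id: "closed_csubspace L \<Longrightarrow> v \<in> L \<Longrightarrow> proj_on L v = v"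
  by (rule proj_on_eqI) (auto simp: cinner.zero_left)

lemma norm_sq_proj_on:
  fixes v :: "'h::chilbert_space"
  assumes L: "closed_csubspace L"
  shows "(norm v)\<^sup>2 = (norm (proj_on L v))\<^sup>2 + (norm (v - proj_on L v))\<^sup>2"
proof -
  have "cinner (proj_on L v) (v - proj_on L v) = 0"
    using proj_on_orth[OF L proj_on_in[OF L]] cinner_eq_0_commute by blast
  from norm_add_sq_orth[OF this] show ?thesis by simp
qed

lemma norm_proj_on_le: "closed_csubspace L \<Longrightarrow> norm (proj_on L v) \<le> norm (v::'h::chilbert_space)"
  using norm_sq_proj_on[of L v] by (intro power2_le_imp_le[OF _ norm_ge_zero]) simp

lemma proj_on_add:
  fixes x y :: "'h::chilbert_space"
  assumes L: "closed_csubspace L"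
  shows "proj_on L (x + y) = proj_on L x + proj_on L y"
  by (rule proj_on_eqI[OF L])
    (simp_all add: cinner.diff_left cinner.add_left cinner_proj_on[OF L]
      closed_csubspaceD(2)[OF L] proj_on_in[OF L])

lemma proj_on_scaleC:
  fixes x :: "'h::chilbert_space"
  assumes L: "closed_csubspace L"
  shows "proj_on L (a *\<^sub>C x) = a *\<^sub>C proj_on L x"
  by (rule proj_on_eqI[OF L])
    (simp_all add: cinner.diff_left cinner_scaleC_left cinner_proj_on[OF L]
      closed_csubspaceD(3)[OF L] proj_on_in[OF L])

lemma proj_on_sum:
  fixes f :: "'i \<Rightarrow> 'h::chilbert_space"
  assumes L: "closed_csubspace L"
  shows "proj_on L (\<Sum>i\<in>F. f i) = (\<Sum>i\<in>F. proj_on L (f i))"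
  by (rule proj_on_eqI[OF L])
    (simp_all add: closed_csubspaceD(6)[OF L] proj_on_in[OF L] cinner.diff_left cinner.sum_left
      cinner_proj_on[OF L])

lemma bounded_op_on_proj_on_comp:
  fixes T :: "'h::chilbert_space \<Rightarrow> 'h"
  assumes T: "bounded_op_on L T" and L': "closed_csubspace L'" "L' \<subseteq> L"
  shows "bounded_op_on L' (\<lambda>x. proj_on L' (T x))"
proof -
  obtain B where B: "\<And>x. x \<in> L \<Longrightarrow> norm (T x) \<le> B * norm x"
    using bounded_op_on_bound[OF T] by metis
  have "norm (proj_on L' (T x)) \<le> B * norm x" if "x \<in> L'" for x
    using norm_proj_on_le[OF L'(1), of "T x"] B[of x] that L'(2) by force
  then show ?thesis
    using L' bounded_op_onD[OF T] unfolding bounded_op_on_def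
    by (auto simp: proj_on_in proj_on_add proj_on_scaleC subset_iff)
qed

text \<open>The orthogonal complement in \<open>L\<close> of the kernel of a nonzero functional is
  spanned by one vector \<open>w\<close>, and a suitable multiple of \<open>w\<close> represents
  \<open>f\<close>. The form relative to \<open>L\<close> is the one that \<open>adj_on\<close>
  requires.\<close>

lemma riesz_representation:
  fixes f :: "'h::chilbert_space \<Rightarrow> complex"
  assumes L: "closed_csubspace L"
    and add: "\<And>x y. x \<in> L \<Longrightarrow> y \<in> L \<Longrightarrow> f (x + y) = f x + f y"
    and scale: "\<And>a x. x \<in> L \<Longrightarrow> f (a *\<^sub>C x) = a * f x"
    and bound: "\<And>x. x \<in> L \<Longrightarrow> cmod (f x) \<le> B * norm x"
  shows "\<exists>z\<in>L. \<forall>x\<in>L. f x = cinner x z"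
proof (cases "\<forall>x\<in>L. f x = 0")
  case True
  then show ?thesis
    using closed_csubspaceD(1)[OF L] by (intro bexI[of _ 0]) (auto simp: cinner.zero_right)
next
  case False
  then obtain u where u: "u \<in> L" "f u \<noteq> 0" by blast
  have diff: "f (x - y) = f x - f y" if "x \<in> L" "y \<in> L" for x y
    using add[of "x - y" y] closed_csubspaceD(4)[OF L that] that by simp
  have f0: "f 0 = 0" using scale[OF closed_csubspaceD(1)[OF L], of 0] by simp
  define Z where "Z = {x \<in> L. f x = 0}"
  have Z: "closed_csubspace Z"
  proof (rule closed_csubspaceI)
    fix h l assume "\<And>n::nat. h n \<in> Z" and l: "h \<longlonglongrightarrow> l"
    then have h: "\<And>n. h n \<in> L" "\<And>n. f (h n) = 0" by (auto simp: Z_def)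
    have "l \<in> L" using closed_csubspace_limit[OF L h(1) l] .
    have "cmod (f l) \<le> B * norm (l - h n)" for n
      using bound[of "l - h n"] closed_csubspaceD(4)[OF L \<open>l \<in> L\<close> h(1)] h \<open>l \<in> L\<close>
      by (simp add: diff)
    moreover have "(\<lambda>n. B * norm (l - h n)) \<longlonglongrightarrow> B * norm (l - l)"
      by (intro tendsto_intros l)
    ultimately have "cmod (f l) \<le> 0"
      by (intro LIMSEQ_le_const[where X = "\<lambda>n. B * norm (l - h n)"]) auto
    then show "l \<in> Z" using \<open>l \<in> L\<close> by (simp add: Z_def)
  qed (simp_all add: Z_def f0 add scale closed_csubspaceD(1-3)[OF L])
  define w where "w = u - proj_on Z u"
  have pZ: "proj_on Z u \<in> L" "f (proj_on Z u) = 0"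
    using proj_on_in[OF Z, of u] by (auto simp: Z_def)
  have w: "w \<in> L" "f w = f u" "\<And>x. x \<in> Z \<Longrightarrow> cinner x w = 0"
    using pZ u closed_csubspaceD(4)[OF L] proj_on_orth[OF Z, of _ u]
    unfolding w_def by (auto simp: diff cinner_eq_0_commute[of _ "u - proj_on Z u"])
  have w0: "cinner w w \<noteq> 0"
    using w(2) u(2) f0 by auto
  have "f x = cinner x ((cnj (f w / cinner w w)) *\<^sub>C w)" if x: "x \<in> L" for x
  proof -
    have "x - (f x / f w) *\<^sub>C w \<in> Z"
      using x w u closed_csubspaceD[OF L] by (simp add: Z_def diff scale)
    then have "cinner (x - (f x / f w) *\<^sub>C w) w = 0" by (rule w(3))
    then have "cinner x w = f x / f w * cinner w w"
      by (simp add: cinner.diff_left cinner_scaleC_left)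
    then show ?thesis
      using w0 w(2) u(2) by (simp add: cinner_scaleC_right)
  qed
  then show ?thesis using w(1) closed_csubspaceD(3)[OF L] by blast
qed

lemma adj_on_eqI:
  fixes T :: "'h::complex_inner \<Rightarrow> 'h"
  assumes L: "closed_csubspace L" and z: "z \<in> L" "\<And>x. x \<in> L \<Longrightarrow> cinner (T x) y = cinner x z"
  shows "adj_on L T y = z"
  unfolding adj_on_def
proof (rule the_equality)
  fix q assume q: "q \<in> L \<and> (\<forall>x\<in>L. cinner (T x) y = cinner x q)"
  have "q - z \<in> L" using closed_csubspaceD[OF L] z(1) q by blast
  then have "cinner (q - z) (q - z) = 0"
    using z(2)[of "q - z"] q by (simp add: cinner.diff_right)
  then show "q = z" by simp
qed (use z in auto)

lemma adj_on:
  fixes T :: "'h::chilbert_space \<Rightarrow> 'h"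
  assumes L: "closed_csubspace L" and T: "bounded_op_on L T"
  shows adj_on_in: "adj_on L T y \<in> L"
    and cinner_adj_on: "x \<in> L \<Longrightarrow> cinner (T x) y = cinner x (adj_on L T y)"
proof -
  obtain B where B: "\<And>x. x \<in> L \<Longrightarrow> norm (T x) \<le> B * norm x"
    using bounded_op_on_bound[OF T] by metis
  have "\<exists>z\<in>L. \<forall>x\<in>L. cinner (T x) y = cinner x z"
  proof (rule riesz_representation[OF L])
    fix x assume "x \<in> L"
    then show "cmod (cinner (T x) y) \<le> (B * norm y) * norm x"
      using order_trans[OF cmod_cinner_le[of "T x" y] mult_right_mono[OF B[of x] norm_ge_zero]]
      by (simp add: algebra_simps)
  qed (simp_all add: bounded_op_onD[OF T] cinner_add_left cinner_scaleC_left)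
  then obtain z where "z \<in> L" "\<forall>x\<in>L. cinner (T x) y = cinner x z" by blast
  moreover from this have "adj_on L T y = z" using adj_on_eqI[OF L] by blast
  ultimately show "adj_on L T y \<in> L" "x \<in> L \<Longrightarrow> cinner (T x) y = cinner x (adj_on L T y)" by auto
qed

lemma bounded_op_on_adj_on:
  fixes T :: "'h::chilbert_space \<Rightarrow> 'h"
  assumes L: "closed_csubspace L" and T: "bounded_op_on L T"
  shows "bounded_op_on L (adj_on L T)"
proof -
  note adj = adj_on_in[OF L T] cinner_adj_on[OF L T]
  obtain B where B: "B \<ge> 0" "\<And>x. x \<in> L \<Longrightarrow> norm (T x) \<le> B * norm x"
    using bounded_op_on_bound[OF T] by metis
  have "norm (adj_on L T y) \<le> B * norm y" for y
  proof (cases "adj_on L T y = 0")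
    case False
    let ?z = "adj_on L T y"
    have "(norm ?z)\<^sup>2 = cmod (cinner ?z ?z)"
      by (simp add: cinner_self norm_power)
    also have "\<dots> = cmod (cinner (T ?z) y)"
      by (simp add: adj)
    also have "\<dots> \<le> (B * norm ?z) * norm y"
      using order_trans[OF cmod_cinner_le mult_right_mono[OF B(2) norm_ge_zero]] adj(1) by blast
    finally show ?thesis
      using False by (simp add: power2_eq_square algebra_simps)
  qed (simp add: B)
  moreover have "adj_on L T (x + y) = adj_on L T x + adj_on L T y" for x y
    by (rule adj_on_eqI[OF L]) (simp_all add: adj cinner_add_right closed_csubspaceD(2)[OF L])
  moreover have "adj_on L T (a *\<^sub>C x) = a *\<^sub>C adj_on L T x" for a x
    by (rule adj_on_eqI[OF L]) (simp_all add: adj cinner_scaleC_right closed_csubspaceD(3)[OF L])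
  ultimately show ?thesis
    using adj(1) unfolding bounded_op_on_def by blast
qed


section \<open>Parseval's identity\<close>

text \<open>For finite \<open>F\<close> the sum \<open>q F\<close> is the best approximation of
  \<open>p\<close> by the \<open>f j\<close> with \<open>j\<close> in \<open>F\<close>, and its
  squared error is what the partial sum lacks. Finite combinations come arbitrarily close to
  \<open>p\<close> and a larger \<open>F\<close> does no worse, so the sums converge along the
  finite subsets of \<open>J\<close>.\<close>

lemma orthonormal_basis_has_sum:
  fixes f :: "'i \<Rightarrow> 'h::chilbert_space"
  assumes "orthonormal_basis J f L"
  shows "((\<lambda>j. (cmod (cinner (f j) v))\<^sup>2) has_sum (norm (proj_on L v))\<^sup>2) J"
proof -
  have on: "\<And>i j. i \<in> J \<Longrightarrow> j \<in> J \<Longrightarrow> cinner (f i) (f j) = (if i = j then 1 else 0)"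
    and L: "L = closed_span (f ` J)"
    using assms unfolding orthonormal_basis_def by auto
  define p where "p = proj_on L v"
  have p: "p \<in> closed_span (f ` J)"
    unfolding p_def L by (rule proj_on_in) simp
  have fp: "cinner (f j) v = cinner (f j) p" if "j \<in> J" for j
    using cinner_proj_on[of L "f j" v] that closed_span_base[of "f j" "f ` J"]
    unfolding p_def L by (metis cinner_commute closed_csubspace_closed_span imageI)
  define a where "a j = cinner p (f j)" for j
  define q where "q F = (\<Sum>j\<in>F. a j *\<^sub>C f j)" for F
  have orth: "cinner (p - q F) (f j) = 0" if "finite F" "F \<subseteq> J" "j \<in> F" for F j
  proof -
    have "cinner (q F) (f j) = (\<Sum>i\<in>F. if i = j then a j else 0)"
      unfolding q_def cinner.sum_left cinner_scaleC_left
      using that on by (intro sum.cong) (auto simp: subset_iff)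
    then show ?thesis using that by (simp add: cinner.diff_left a_def)
  qed
  have best: "(norm p)\<^sup>2 - (\<Sum>j\<in>F. (cmod (cinner (f j) v))\<^sup>2) = (norm (p - q F))\<^sup>2"
      "(norm (p - q F))\<^sup>2 \<le> (norm (p - (\<Sum>j\<in>F. b j *\<^sub>C f j)))\<^sup>2" if F: "finite F" "F \<subseteq> J" for F b
  proof -
    have *: "cinner (p - q F) (\<Sum>j\<in>F. r j *\<^sub>C f j) = 0" for r
      using orth[OF F] by (simp add: cinner.sum_right cinner_scaleC_right)
    have sq: "(norm (q F))\<^sup>2 = (\<Sum>j\<in>F. (cmod (cinner (f j) v))\<^sup>2)"
    proof -
      have "norm (f j) = 1" if "j \<in> F" for j
        using on[of j j] that F unfolding cinner_self by (auto simp: norm_eq_1 power2_norm_eq_inner)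
      then have "(\<Sum>j\<in>F. (norm (a j *\<^sub>C f j))\<^sup>2) = (\<Sum>j\<in>F. (cmod (cinner (f j) v))\<^sup>2)"
        using F fp by (intro sum.cong) (auto simp: norm_scaleC a_def cmod_cinner_commute[of p])
      moreover have "(norm (q F))\<^sup>2 = (\<Sum>j\<in>F. (norm (a j *\<^sub>C f j))\<^sup>2)"
        unfolding q_def using F on
        by (intro norm_sq_sum_orth) (auto simp: cinner_scaleC_left cinner_scaleC_right subset_iff)
      ultimately show ?thesis by simp
    qed
    show "(norm p)\<^sup>2 - (\<Sum>j\<in>F. (cmod (cinner (f j) v))\<^sup>2) = (norm (p - q F))\<^sup>2"
      using norm_add_sq_orth[OF *[of a, folded q_def]] sq by simp
    have "(p - q F) + (\<Sum>j\<in>F. (a j - b j) *\<^sub>C f j) = p - (\<Sum>j\<in>F. b j *\<^sub>C f j)"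
      by (simp add: q_def scaleC.diff_left sum_subtractf)
    then show "(norm (p - q F))\<^sup>2 \<le> (norm (p - (\<Sum>j\<in>F. b j *\<^sub>C f j)))\<^sup>2"
      using norm_add_sq_orth[OF *[of "\<lambda>j. a j - b j"]] by (simp only:) simp
  qed
  have "((\<lambda>j. (cmod (cinner (f j) v))\<^sup>2) has_sum (norm p)\<^sup>2) J"
    unfolding has_sum_def
  proof (rule tendstoI)
    fix \<epsilon> :: real assume "\<epsilon> > 0"
    obtain u where u: "u \<in> cspan (f ` J)" "dist u p < sqrt \<epsilon>"
      using p \<open>\<epsilon> > 0\<close> unfolding closed_span_def closure_approachable by (metis real_sqrt_gt_zero)
    then obtain F b where F: "finite F" "F \<subseteq> J" and ub: "u = (\<Sum>j\<in>F. b j *\<^sub>C f j)"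
    proof -
      obtain t r where t: "finite t" "t \<subseteq> f ` J" "u = (\<Sum>x\<in>t. r x *\<^sub>C x)"
        using u(1) unfolding complex_vector.span_explicit by blast
      \<comment> \<open>Choosing indices on which \<open>f\<close> is injective turns the
        combination over vectors into one over indices.\<close>
      obtain F where F: "F \<subseteq> J" "inj_on f F" "t = f ` F"
        using t(2) unfolding subset_image_inj by blast
      then have "finite F"
        using t(1) finite_imageD by blast
      then show ?thesis
        using that[of F "\<lambda>j. r (f j)"] t(3) F by (simp add: sum.reindex)
    qed
    have "dist (\<Sum>j\<in>G. (cmod (cinner (f j) v))\<^sup>2) ((norm p)\<^sup>2) < \<epsilon>"
      if G: "finite G" "F \<subseteq> G" "G \<subseteq> J" for G
    proof -
      \<comment> \<open>Padding with zero coefficients makes \<open>u\<close> a competitor over the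
        larger set \<open>G\<close>.\<close>
      have "u = (\<Sum>j\<in>G. (if j \<in> F then b j else 0) *\<^sub>C f j)"
        unfolding ub using G by (intro sum.mono_neutral_cong_left) auto
      then have "(norm (p - q G))\<^sup>2 \<le> (norm (p - u))\<^sup>2"
        using best(2)[OF G(1,3)] by metis
      also have "\<dots> < (sqrt \<epsilon>)\<^sup>2"
        using u(2) \<open>\<epsilon> > 0\<close> by (intro power_strict_mono) (auto simp: dist_norm norm_minus_commute)
      finally have "(norm (p - q G))\<^sup>2 < \<epsilon>"
        using \<open>\<epsilon> > 0\<close> by simp
      then show ?thesis
        by (subst dist_commute) (simp add: dist_real_def best(1)[OF G(1,3)])
    qed
    then show "\<forall>\<^sub>F G in finite_subsets_at_top J.
        dist (\<Sum>j\<in>G. (cmod (cinner (f j) v))\<^sup>2) ((norm p)\<^sup>2) < \<epsilon>"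
      unfolding eventually_finite_subsets_at_top using F by blast
  qed
  then show ?thesis unfolding p_def .
qed


section \<open>Cuntz representations\<close>

lemma words_Nil [simp]: "[] \<in> words N"
  by (simp add: words_def)

lemma words_Cons [simp]: "i # w \<in> words N \<longleftrightarrow> i < N \<and> w \<in> words N"
  by (simp add: words_def)

lemma words_append [simp]: "v @ w \<in> words N \<longleftrightarrow> v \<in> words N \<and> w \<in> words N"
  by (auto simp: words_def)

lemma word_op_append: "word_op S (v @ w) x = word_op S v (word_op S w x)"
  by (induction v) auto

locale cuntz_representation =
  fixes N :: nat and H :: "'h::chilbert_space set" and S :: "nat \<Rightarrow> 'h \<Rightarrow> 'h"
  assumes cuntz_rep: "cuntz_rep N H S"
begin

abbreviation Sa :: "nat \<Rightarrow> 'h \<Rightarrow> 'h" where "Sa i \<equiv> adj_on H (S i)"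

lemma closed_H: "closed_csubspace H"
  and bounded_S: "i < N \<Longrightarrow> bounded_op_on H (S i)"
  and sum_S_Sa: "x \<in> H \<Longrightarrow> (\<Sum>i<N. S i (Sa i x)) = x"
  and Sa_S: "i < N \<Longrightarrow> j < N \<Longrightarrow> x \<in> H \<Longrightarrow> Sa j (S i x) = (if i = j then x else 0)"
  using cuntz_rep unfolding cuntz_rep_def by blast+

lemmas S_in = bounded_op_onD(1)[OF bounded_S]
  and S_add = bounded_op_onD(2)[OF bounded_S]
  and S_scaleC = bounded_op_onD(3)[OF bounded_S]
  and S_zero = bounded_op_on_0[OF bounded_S closed_H]
  and S_diff = bounded_op_on_diff[OF bounded_S closed_H]

lemma bounded_Sa: "i < N \<Longrightarrow> bounded_op_on H (Sa i)"
  by (rule bounded_op_on_adj_on[OF closed_H bounded_S])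

lemmas Sa_in = bounded_op_onD(1)[OF bounded_Sa]
  and Sa_add = bounded_op_onD(2)[OF bounded_Sa]
  and Sa_scaleC = bounded_op_onD(3)[OF bounded_Sa]
  and Sa_diff = bounded_op_on_diff[OF bounded_Sa closed_H]

lemma cinner_S: "i < N \<Longrightarrow> x \<in> H \<Longrightarrow> cinner (S i x) y = cinner x (Sa i y)"
  by (rule cinner_adj_on[OF closed_H bounded_S])

lemma cinner_Sa: "i < N \<Longrightarrow> y \<in> H \<Longrightarrow> cinner (Sa i x) y = cinner x (S i y)"
  using cinner_S[of i y x] by (metis cinner_commute)

lemma cinner_S_S:
  "i < N \<Longrightarrow> j < N \<Longrightarrow> x \<in> H \<Longrightarrow> y \<in> H \<Longrightarrow>
    cinner (S i x) (S j y) = (if i = j then cinner x y else 0)"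
  by (simp add: cinner_S Sa_S cinner.zero_right)

lemma norm_S: "i < N \<Longrightarrow> x \<in> H \<Longrightarrow> norm (S i x) = norm x"
  using cinner_S_S[of i i x x] by (simp add: cinner_self power2_eq_iff_nonneg flip: of_real_power)

lemma sum_S_in: "(\<And>i. i < N \<Longrightarrow> y i \<in> H) \<Longrightarrow> (\<Sum>i<N. S i (y i)) \<in> H"
  by (rule closed_csubspaceD(6)[OF closed_H]) (simp add: S_in)

lemma cinner_sum_S_left:
  assumes "\<And>i. i < N \<Longrightarrow> y i \<in> H"
  shows "cinner (\<Sum>i<N. S i (y i)) z = (\<Sum>i<N. cinner (y i) (Sa i z))"
  using assms by (simp add: cinner.sum_left cinner_S)

lemma Sa_sum_S:
  assumes "j < N" "\<And>i. i < N \<Longrightarrow> y i \<in> H"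
  shows "Sa j (\<Sum>i<N. S i (y i)) = y j"
proof -
  have "Sa j (\<Sum>i<N. S i (y i)) = (\<Sum>i<N. Sa j (S i (y i)))"
    using assms by (intro bounded_op_on_sum[OF bounded_Sa closed_H]) (auto simp: S_in)
  also have "\<dots> = (\<Sum>i<N. if i = j then y j else 0)"
    using assms by (intro sum.cong) (auto simp: Sa_S)
  finally show ?thesis using assms(1) by simp
qed

lemma norm_sum_S:
  assumes "\<And>i. i < N \<Longrightarrow> y i \<in> H"
  shows "(norm (\<Sum>i<N. S i (y i)))\<^sup>2 = (\<Sum>i<N. (norm (y i))\<^sup>2)"
proof -
  have "(norm (\<Sum>i<N. S i (y i)))\<^sup>2 = (\<Sum>i<N. (norm (S i (y i)))\<^sup>2)"
    using assms by (intro norm_sq_sum_orth) (auto simp: cinner_S_S)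
  then show ?thesis using assms by (simp add: norm_S)
qed

text \<open>The column of the \<open>Sa i\<close> is an isometry. This gives the uniform bound on
  \<open>lift\<close> and turns the squared weights of the walk into transition
  probabilities.\<close>

lemma sum_norm_Sa: "x \<in> H \<Longrightarrow> (\<Sum>i<N. (norm (Sa i x))\<^sup>2) = (norm x)\<^sup>2"
  using norm_sum_S[of "\<lambda>i. Sa i x"] by (simp add: sum_S_Sa Sa_in)

lemma word_in: "w \<in> words N \<Longrightarrow> x \<in> H \<Longrightarrow> word_op S w x \<in> H"
  by (induction w) (auto simp: S_in)

lemma cinner_word_word:
  "w \<in> words N \<Longrightarrow> x \<in> H \<Longrightarrow> y \<in> H \<Longrightarrow> cinner (word_op S w x) (word_op S w y) = cinner x y"
  by (induction w) (auto simp: cinner_S_S word_in)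

lemma bounded_word: "w \<in> words N \<Longrightarrow> bounded_op_on H (word_op S w)"
proof -
  assume w: "w \<in> words N"
  then have norm: "norm (word_op S w x) = norm x" if "x \<in> H" for x
    using that by (induction w) (auto simp: norm_S word_in)
  have "word_op S w (x + y) = word_op S w x + word_op S w y" if "x \<in> H" "y \<in> H" for x y
    using w that by (induction w) (auto simp: S_add word_in)
  moreover have "word_op S w (a *\<^sub>C x) = a *\<^sub>C word_op S w x" if "x \<in> H" for a x
    using w that by (induction w) (auto simp: S_scaleC word_in)
  moreover have "\<exists>B. \<forall>x\<in>H. norm (word_op S w x) \<le> B * norm x"
    using norm by (intro exI[of _ 1]) simp
  ultimately show ?thesis
    using w unfolding bounded_op_on_def by (auto simp: word_in)
qed

section \<open>The commutant and the reducing subspaces\<close>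

definition commutes :: "('h \<Rightarrow> 'h) \<Rightarrow> bool" where
  "commutes T \<longleftrightarrow> bounded_op_on H T \<and>
     (\<forall>i<N. \<forall>x\<in>H. T (S i x) = S i (T x) \<and> T (Sa i x) = Sa i (T x))"

lemma irreducible_rep_iff: "irreducible_rep N H S \<longleftrightarrow> (\<forall>T. commutes T \<longrightarrow> scalar_on H T)"
  by (simp add: irreducible_rep_def commutes_def)

lemma commutes_diff_scaleC: "commutes T \<Longrightarrow> commutes (\<lambda>x. T x - a *\<^sub>C x)"
  using closed_csubspaceD(3)[OF closed_H] unfolding commutes_def
  by (auto simp: bounded_op_on_diff_scaleC closed_H S_diff Sa_diff S_scaleC Sa_scaleC bounded_op_onD)

definition invariant :: "'h set \<Rightarrow> bool" where
  "invariant W \<longleftrightarrow> closed_csubspace W \<and> W \<subseteq> H \<and> (\<forall>i<N. \<forall>x\<in>W. S i x \<in> W \<and> Sa i x \<in> W)"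

text \<open>Invariance of \<open>W\<close> under \<open>Sa i\<close> makes \<open>S i\<close> send
  the residual \<open>x - proj_on W x\<close> into the orthogonal complement of \<open>W\<close>;
  invariance under \<open>S i\<close> does the same for \<open>Sa i\<close>.\<close>

lemma commutes_proj_on:
  assumes "invariant W"
  shows "commutes (proj_on W)"
proof -
  have W: "closed_csubspace W" "W \<subseteq> H"
    and inv: "\<And>i x. i < N \<Longrightarrow> x \<in> W \<Longrightarrow> S i x \<in> W" "\<And>i x. i < N \<Longrightarrow> x \<in> W \<Longrightarrow> Sa i x \<in> W"
    using assms unfolding invariant_def by auto
  note p = proj_on_in[OF W(1)]
  have "bounded_op_on H (proj_on W)"
    using W(2) p norm_proj_on_le[OF W(1)] unfolding bounded_op_on_def
    by (auto simp: proj_on_add[OF W(1)] proj_on_scaleC[OF W(1)] intro!: exI[of _ 1])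
  moreover have "proj_on W (S i x) = S i (proj_on W x)" if "i < N" "x \<in> H" for i x
  proof (rule proj_on_eqI[OF W(1)])
    fix y assume "y \<in> W"
    then have "cinner (x - proj_on W x) (Sa i y) = 0"
      using that inv(2) proj_on_orth[OF W(1)] by blast
    then show "cinner (S i x - S i (proj_on W x)) y = 0"
      using that W(2) p by (simp add: cinner.diff_left cinner_S subset_iff)
  qed (use that inv(1) p in auto)
  moreover have "proj_on W (Sa i x) = Sa i (proj_on W x)" if "i < N" "x \<in> H" for i x
  proof (rule proj_on_eqI[OF W(1)])
    fix y assume "y \<in> W"
    then have "cinner (x - proj_on W x) (S i y) = 0" "y \<in> H"
      using that inv(1) W(2) proj_on_orth[OF W(1)] by blast+
    then show "cinner (Sa i x - Sa i (proj_on W x)) y = 0"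
      using that by (simp add: cinner.diff_left cinner_Sa)
  qed (use that inv(2) p in auto)
  ultimately show ?thesis unfolding commutes_def by blast
qed

text \<open>Adjoints depend on the space in which they are taken. Since \<open>Sa i\<close> maps
  \<open>W\<close> into itself, it also has the defining property of the adjoint inside
  \<open>W\<close>.\<close>

lemma adj_on_invariant:
  assumes "invariant W" "i < N" "x \<in> W"
  shows "adj_on W (S i) x = Sa i x"
  using assms unfolding invariant_def by (intro adj_on_eqI) (auto intro!: cinner_S)

lemma cuntz_rep_invariant:
  assumes W: "invariant W"
  shows "cuntz_rep N W S"
proof -
  have "bounded_op_on W (S i)" if "i < N" for i
    using W that by (intro bounded_op_on_subset[OF bounded_S[OF that]]) (auto simp: invariant_def)
  moreover have "adj_on W (S j) (S i x) = Sa j (S i x)" if "i < N" "j < N" "x \<in> W" for i j x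
    using W that by (intro adj_on_invariant) (auto simp: invariant_def)
  ultimately show ?thesis
    using W adj_on_invariant[OF W] sum_S_Sa Sa_S unfolding cuntz_rep_def invariant_def
    by (auto simp: subset_iff)
qed

lemma closed_span_invariant:
  assumes A: "A \<subseteq> H" "\<And>i x. i < N \<Longrightarrow> x \<in> A \<Longrightarrow> S i x \<in> closed_span A \<and> Sa i x \<in> closed_span A"
  shows "invariant (closed_span A)"
  unfolding invariant_def
proof (intro conjI allI impI ballI)
  show "closed_span A \<subseteq> H"
    by (rule closed_span_minimal[OF A(1) closed_H])
  fix i x assume i: "i < N" and x: "x \<in> closed_span A"
  show "S i x \<in> closed_span A"
    by (rule bounded_op_on_closed_span[OF bounded_S[OF i] closed_H _ _ x]) (use A i in auto)
  show "Sa i x \<in> closed_span A"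
    by (rule bounded_op_on_closed_span[OF bounded_Sa[OF i] closed_H _ _ x]) (use A i in auto)
qed simp

end


section \<open>The commutant of a Cuntz dilation\<close>

locale dilation = cuntz_representation N H S
  for N :: nat and H :: "'h::chilbert_space set" and S :: "nat \<Rightarrow> 'h \<Rightarrow> 'h" +
  fixes K :: "'h set" and V :: "nat \<Rightarrow> 'h \<Rightarrow> 'h"
  assumes dilation: "cuntz_dilation N K V H S"
begin

lemma closed_K: "closed_csubspace K"
  and bounded_V: "i < N \<Longrightarrow> bounded_op_on K (V i)"
  and K_sub: "x \<in> K \<Longrightarrow> x \<in> H"
  and Sa_in_K: "i < N \<Longrightarrow> x \<in> K \<Longrightarrow> Sa i x \<in> K"
  and adj_V: "i < N \<Longrightarrow> x \<in> K \<Longrightarrow> adj_on K (V i) x = Sa i x"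
  and cyclic: "cyclic_for N H S K"
  using dilation unfolding cuntz_dilation_def row_coisometry_def by blast+

lemmas V_in = bounded_op_onD(1)[OF bounded_V]

lemma cinner_V: "i < N \<Longrightarrow> x \<in> K \<Longrightarrow> y \<in> K \<Longrightarrow> cinner (V i x) y = cinner x (Sa i y)"
  by (simp add: cinner_adj_on[OF closed_K bounded_V] adj_V)

lemma word_V_in: "w \<in> words N \<Longrightarrow> x \<in> K \<Longrightarrow> word_op V w x \<in> K"
  by (induction w) (auto simp: V_in)

text \<open>On both sides the first letter moves to the right factor as \<open>Sa i\<close>, which
  keeps that factor in \<open>K\<close>. So the words in \<open>V\<close> are compressions of the
  words in \<open>S\<close>, which links the frame vectors in \<open>K\<close> to the orthonormal
  families in \<open>H\<close>.\<close>

lemma cinner_word_V: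
  assumes "w \<in> words N" "x \<in> K" "y \<in> K"
  shows "cinner (word_op V w x) y = cinner (word_op S w x) y"
  using assms
proof (induction w arbitrary: y)
  case (Cons i w)
  then show ?case
    by (simp add: cinner_V word_V_in cinner_S K_sub word_in Sa_in_K)
qed simp

text \<open>Words mixing the \<open>S i\<close> with their adjoints reduce to pure ones:
  \<open>Sa i\<close> cancels the first letter, or kills the vector, or meets the empty word and
  acts inside \<open>K\<close>.\<close>

lemma closed_span_words: "closed_span {word_op S w x |w x. w \<in> words N \<and> x \<in> K} = H"
  (is "closed_span ?D = H")
proof
  have D: "?D \<subseteq> H"
    using word_in K_sub by auto
  then show "closed_span ?D \<subseteq> H"
    by (rule closed_span_minimal[OF _ closed_H])
  have "invariant (closed_span ?D)"
  proof (rule closed_span_invariant[OF D])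
    fix i u assume i: "i < N" and "u \<in> ?D"
    then obtain w x where u: "u = word_op S w x" and wx: "w \<in> words N" "x \<in> K" by blast
    have "S i u = word_op S (i # w) x" "i # w \<in> words N"
      using u i wx by auto
    then have "S i u \<in> ?D" using wx(2) by blast
    moreover have "Sa i u \<in> closed_span ?D"
    proof (cases w)
      case Nil
      then have "Sa i u = word_op S [] (Sa i x)" "Sa i x \<in> K" "[] \<in> words N"
        using u wx i Sa_in_K by auto
      then have "Sa i u \<in> ?D" by blast
      then show ?thesis by (rule closed_span_base)
    next
      case (Cons j v)
      then have "Sa i u = (if j = i then word_op S v x else 0)"
        using u wx i by (simp add: Sa_S word_in K_sub)
      moreover have "word_op S v x \<in> ?D"
        using Cons wx by auto
      ultimately show ?thesis
        using closed_span_base[of "word_op S v x" ?D]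
          closed_csubspaceD(1)[OF closed_csubspace_closed_span, of ?D]
        by (cases "j = i") simp_all
    qed
    ultimately show "S i u \<in> closed_span ?D \<and> Sa i u \<in> closed_span ?D"
      using closed_span_base[of "S i u" ?D] by (intro conjI)
  qed
  then have inv: "S i u \<in> closed_span ?D" "Sa i u \<in> closed_span ?D"
    if "i < N" "u \<in> closed_span ?D" for i u
    using that unfolding invariant_def by blast+
  have "star_word_op H S w x \<in> closed_span ?D" if "w \<in> lists ({..<N} \<times> UNIV)" "x \<in> K" for w x
    using that(1)
  proof (induction w)
    case Nil
    have "word_op S [] x \<in> ?D" using that(2) words_Nil by blast
    then show ?case by (simp add: closed_span_base)
  next
    case (Cons a w)
    then show ?case by (cases a) (auto simp: inv)
  qed
  then have "closed_span {star_word_op H S w x |w x. w \<in> lists ({..<N} \<times> UNIV) \<and> x \<in> K}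
      \<subseteq> closed_span ?D"
    by (intro closed_span_mono) blast
  then show "H \<subseteq> closed_span ?D"
    using cyclic unfolding cyclic_for_def by simp
qed

text \<open>This is injectivity of the compression. Letters can be moved across \<open>B\<close>, so
  every matrix entry of \<open>B\<close> between words applied to \<open>K\<close> reduces to an
  entry between vectors of \<open>K\<close>; such words span a dense subspace.\<close>

lemma commutes_eq_0:
  assumes B: "commutes B" and zero: "\<And>x y. x \<in> K \<Longrightarrow> y \<in> K \<Longrightarrow> cinner (B x) y = 0"
    and "x \<in> H"
  shows "B x = 0"
proof -
  have bB: "bounded_op_on H B"
    and comm: "\<And>i x. i < N \<Longrightarrow> x \<in> H \<Longrightarrow> B (S i x) = S i (B x)"
      "\<And>i x. i < N \<Longrightarrow> x \<in> H \<Longrightarrow> B (Sa i x) = Sa i (B x)"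
    using B unfolding commutes_def by auto
  note B_in = bounded_op_onD(1)[OF bB]
  \<comment> \<open>The letters of \<open>w\<close> pass through \<open>B\<close> as adjoints and
    are absorbed by \<open>x\<close>, which stays in \<open>K\<close>.\<close>
  have right: "cinner (B x) (word_op S w y) = 0" if "w \<in> words N" "x \<in> K" "y \<in> K" for w x y
    using that
  proof (induction w arbitrary: x)
    case Nil
    then show ?case by (simp add: zero)
  next
    case (Cons i w)
    then have "cinner (B x) (S i (word_op S w y)) = cinner (B (Sa i x)) (word_op S w y)"
      by (simp add: comm K_sub cinner_Sa word_in)
    then show ?case using Cons by (simp add: Sa_in_K)
  qed
  \<comment> \<open>Now the letters of \<open>v\<close> leave \<open>B\<close> on the left. Each one
    is absorbed by \<open>y\<close> if \<open>w\<close> is empty; otherwise it cancels against the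
    first letter of \<open>w\<close> or gives 0.\<close>
  have words: "cinner (B (word_op S v x)) (word_op S w y) = 0"
    if "v \<in> words N" "w \<in> words N" "x \<in> K" "y \<in> K" for v w x y
    using that
  proof (induction v arbitrary: w y)
    case Nil
    then show ?case by (simp add: right)
  next
    case (Cons i v)
    have Bi: "B (word_op S (i # v) x) = S i (B (word_op S v x))" "B (word_op S v x) \<in> H"
      using Cons.prems by (simp_all add: comm word_in K_sub B_in)
    show ?case
    proof (cases w)
      case Nil
      then show ?thesis
        using Cons.IH[of "[]" "Sa i y"] Cons.prems Bi by (simp add: cinner_S Sa_in_K)
    next
      case (Cons j w')
      then show ?thesis
        using Cons.IH[of w' y] Cons.prems Bi by (simp add: cinner_S_S word_in K_sub)
    qed
  qed
  have "B u \<in> {0}" if "u \<in> {word_op S w x |w x. w \<in> words N \<and> x \<in> K}" for u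
  proof -
    have "u \<in> H" using that word_in K_sub by auto
    then have "B u \<in> closed_span {word_op S w x |w x. w \<in> words N \<and> x \<in> K}"
      unfolding closed_span_words by (rule B_in)
    then have "cinner (B u) (B u) = 0"
      by (rule orth_closed_span) (use that words in auto)
    then show ?thesis by simp
  qed
  then have "B x \<in> {0}"
    using \<open>x \<in> H\<close> closed_span_words word_in K_sub
    by (intro bounded_op_on_closed_span[OF bB closed_H closed_csubspace_zero,
          of "{word_op S w x |w x. w \<in> words N \<and> x \<in> K}"]) auto
  then show ?thesis by simp
qed

section \<open>Fixed points on \<open>K\<close> and their lifts to the commutant\<close>

definition fixed_point :: "('h \<Rightarrow> 'h) \<Rightarrow> bool" where
  "fixed_point T \<longleftrightarrow> bounded_op_on K T \<and> (\<forall>x\<in>K. (\<Sum>i<N. V i (T (Sa i x))) = T x)"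

text \<open>Tested against \<open>y\<close> in \<open>K\<close>, the sum becomes that of the numbers
  \<open>cinner (Sa i (T x)) (Sa i y)\<close>, and \<open>sum_S_Sa\<close> collapses it to
  \<open>cinner (T x) y\<close>. On \<open>K\<close> the operators \<open>Sa i\<close> are the
  adjoints of the \<open>V i\<close>.\<close>

lemma fixed_point_compression:
  assumes T: "commutes T"
  shows "fixed_point (\<lambda>x. proj_on K (T x))"
proof -
  have bT: "bounded_op_on H T"
    and comm: "\<And>i x. i < N \<Longrightarrow> x \<in> H \<Longrightarrow> T (Sa i x) = Sa i (T x)"
    using T unfolding commutes_def by auto
  note P_in = proj_on_in[OF closed_K]
  have "(\<Sum>i<N. V i (proj_on K (T (Sa i x)))) = proj_on K (T x)" if x: "x \<in> K" for x
  proof (rule eq_if_cinner_eq[OF closed_K])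
    show "(\<Sum>i<N. V i (proj_on K (T (Sa i x)))) \<in> K"
      by (intro closed_csubspaceD(6)[OF closed_K] V_in P_in) simp
    fix y assume y: "y \<in> K"
    have "T x \<in> H" using x K_sub bounded_op_onD(1)[OF bT] by blast
    have "cinner (\<Sum>i<N. V i (proj_on K (T (Sa i x)))) y
        = (\<Sum>i<N. cinner (proj_on K (T (Sa i x))) (Sa i y))"
      using y by (simp add: cinner.sum_left cinner_V P_in)
    also have "\<dots> = (\<Sum>i<N. cinner (Sa i (T x)) (Sa i y))"
      using x y by (simp add: cinner_proj_on[OF closed_K] Sa_in_K comm K_sub)
    also have "\<dots> = cinner (\<Sum>i<N. S i (Sa i (T x))) y"
      using \<open>T x \<in> H\<close> by (simp add: cinner_sum_S_left Sa_in)
    also have "\<dots> = cinner (proj_on K (T x)) y"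
      using \<open>T x \<in> H\<close> y by (simp add: sum_S_Sa cinner_proj_on[OF closed_K])
    finally show "cinner (\<Sum>i<N. V i (proj_on K (T (Sa i x)))) y = cinner (proj_on K (T x)) y" .
  qed (rule P_in)
  moreover have "bounded_op_on K (\<lambda>x. proj_on K (T x))"
    using K_sub by (intro bounded_op_on_proj_on_comp[OF bT closed_K]) auto
  ultimately show ?thesis unfolding fixed_point_def by blast
qed

text \<open>For a fixed point \<open>T\<close> these operators form, on each vector of \<open>K\<close>, a bounded martingale with
  respect to the increasing subspaces \<open>\<Oplus> S\<^sub>w K\<close>, \<open>|w| = n\<close>; hence they converge strongly, and the
  limit is the operator in the commutant whose compression to \<open>K\<close> is \<open>T\<close>.\<close>

primrec lift :: "('h \<Rightarrow> 'h) \<Rightarrow> nat \<Rightarrow> 'h \<Rightarrow> 'h" where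
  "lift T 0 x = T (proj_on K x)"
| "lift T (Suc n) x = (\<Sum>i<N. S i (lift T n (Sa i x)))"

context
  fixes T :: "'h \<Rightarrow> 'h"
  assumes T: "fixed_point T"
begin

lemma bounded_T: "bounded_op_on K T" and T_fix: "x \<in> K \<Longrightarrow> (\<Sum>i<N. V i (T (Sa i x))) = T x"
  using T unfolding fixed_point_def by auto

lemma T_in: "x \<in> K \<Longrightarrow> T x \<in> K"
  by (rule bounded_op_onD(1)[OF bounded_T])

lemma lift_in: "x \<in> H \<Longrightarrow> lift T n x \<in> H"
  by (induction n arbitrary: x) (auto simp: Sa_in T_in K_sub proj_on_in[OF closed_K] intro!: sum_S_in)

lemma lift_add: "x \<in> H \<Longrightarrow> y \<in> H \<Longrightarrow> lift T n (x + y) = lift T n x + lift T n y"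
proof (induction n arbitrary: x y)
  case 0
  show ?case
    by (simp add: proj_on_add[OF closed_K] bounded_op_onD(2)[OF bounded_T] proj_on_in[OF closed_K])
qed (simp add: Sa_add Sa_in S_add lift_in sum.distrib)

lemma lift_scaleC: "x \<in> H \<Longrightarrow> lift T n (a *\<^sub>C x) = a *\<^sub>C lift T n x"
proof (induction n arbitrary: x)
  case 0
  show ?case
    by (simp add: proj_on_scaleC[OF closed_K] bounded_op_onD(3)[OF bounded_T] proj_on_in[OF closed_K])
qed (simp add: Sa_scaleC Sa_in S_scaleC lift_in scaleC.sum_right)

text \<open>The ranges of the \<open>S i\<close> are orthogonal and the column of the
  \<open>Sa i\<close> is isometric, so the bound of \<open>T\<close> survives every level.\<close>

lemma norm_lift:
  assumes C: "C \<ge> 0" "\<And>x. x \<in> K \<Longrightarrow> norm (T x) \<le> C * norm x"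
  shows "x \<in> H \<Longrightarrow> norm (lift T n x) \<le> C * norm x"
proof (induction n arbitrary: x)
  case 0
  show ?case
    using C(2)[OF proj_on_in[OF closed_K], of x]
      mult_left_mono[OF norm_proj_on_le[OF closed_K, of x] C(1)] by simp
next
  case (Suc n)
  have "(norm (lift T (Suc n) x))\<^sup>2 = (\<Sum>i<N. (norm (lift T n (Sa i x)))\<^sup>2)"
    using Suc.prems by (simp add: norm_sum_S lift_in Sa_in)
  also have "\<dots> \<le> (\<Sum>i<N. (C * norm (Sa i x))\<^sup>2)"
    using Suc by (intro sum_mono power_mono) (auto simp: Sa_in)
  also have "\<dots> = (C * norm x)\<^sup>2"
    using sum_norm_Sa[OF Suc.prems] by (simp add: power_mult_distrib flip: sum_distrib_left)
  finally show ?case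
    by (rule power2_le_imp_le) (simp add: C(1))
qed

text \<open>One more level of \<open>lift\<close> acts on the compression to \<open>K\<close> as the
  map of which \<open>T\<close> is a fixed point, so the compression never changes.\<close>

lemma cinner_lift: "x \<in> K \<Longrightarrow> y \<in> K \<Longrightarrow> cinner (lift T n x) y = cinner (T x) y"
proof (induction n arbitrary: x y)
  case 0
  then show ?case by (simp add: proj_on_id[OF closed_K])
next
  case (Suc n)
  have "cinner (lift T (Suc n) x) y = (\<Sum>i<N. cinner (T (Sa i x)) (Sa i y))"
    using Suc by (simp add: cinner_sum_S_left lift_in Sa_in K_sub Sa_in_K)
  also have "\<dots> = cinner (\<Sum>i<N. V i (T (Sa i x))) y"
    using Suc.prems by (simp add: cinner.sum_left cinner_V T_in Sa_in_K)
  finally show ?case using Suc.prems by (simp add: T_fix)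
qed

text \<open>The martingale property: the increment from level \<open>m\<close> to level
  \<open>n\<close> is orthogonal to all that level \<open>m\<close> produces from \<open>K\<close>.
  Removing the outer \<open>S i\<close> on both sides lowers both levels until \<open>m\<close> is
  0, where \<open>cinner_lift\<close> applies.\<close>

lemma cinner_lift_lift:
  "m \<le> n \<Longrightarrow> x \<in> K \<Longrightarrow> y \<in> K \<Longrightarrow>
    cinner (lift T n x) (lift T m y) = cinner (lift T m x) (lift T m y)"
proof (induction m arbitrary: n x y)
  case 0
  then show ?case by (simp add: proj_on_id[OF closed_K] cinner_lift T_in)
next
  case (Suc m)
  then obtain k where n: "n = Suc k" "m \<le> k" by (cases n) auto
  have eq: "cinner (lift T (Suc l) x) (lift T (Suc m) y)
      = (\<Sum>i<N. cinner (lift T l (Sa i x)) (lift T m (Sa i y)))" for l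
    unfolding lift.simps using Suc.prems
    by (subst cinner_sum_S_left) (auto simp: lift_in Sa_in K_sub Sa_sum_S)
  show ?case
    unfolding n(1) eq using Suc.IH[OF n(2)] Suc.prems by (simp add: Sa_in_K)
qed

text \<open>The increments are orthogonal to the earlier values, so the squared norms increase; they
  are bounded, and their differences are the squared norms of the increments.\<close>

lemma convergent_lift_K:
  assumes x: "x \<in> K"
  shows "convergent (\<lambda>n. lift T n x)"
proof -
  obtain C where C: "C \<ge> 0" "\<And>x. x \<in> K \<Longrightarrow> norm (T x) \<le> C * norm x"
    using bounded_op_on_bound[OF bounded_T] by metis
  define a where "a n = (norm (lift T n x))\<^sup>2" for n
  have diff: "(norm (lift T n x - lift T m x))\<^sup>2 = a n - a m" if "m \<le> n" for m n
  proof -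
    have "cinner (lift T m x) (lift T n x - lift T m x) = 0"
      using cinner_lift_lift[OF that x x]
      by (subst cinner_eq_0_commute) (simp add: cinner.diff_left)
    from norm_add_sq_orth[OF this] show ?thesis by (simp add: a_def)
  qed
  have "incseq a"
    using diff zero_le_power2 by (metis diff_ge_0_iff_ge incseq_def)
  moreover have "a n \<le> (C * norm x)\<^sup>2" for n
    unfolding a_def by (intro power_mono norm_lift C) (use x K_sub in auto)
  ultimately have "convergent a"
    using incseq_convergent[of a] by (metis convergent_def)
  then have "Cauchy a"
    by (simp add: Cauchy_convergent_iff)
  have "Cauchy (\<lambda>n. lift T n x)"
  proof (rule CauchyI')
    fix e :: real assume "e > 0"
    then obtain k where k: "\<And>m n. m \<ge> k \<Longrightarrow> n \<ge> k \<Longrightarrow> norm (a m - a n) < e\<^sup>2"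
      using CauchyD[OF \<open>Cauchy a\<close>, of "e\<^sup>2"] by auto
    have "dist (lift T m x) (lift T n x) < e" if "m \<ge> k" "n > m" for m n
    proof -
      have "(norm (lift T m x - lift T n x))\<^sup>2 < e\<^sup>2"
        using k[of n m] that diff[of m n] by (simp add: norm_minus_commute)
      then show ?thesis using \<open>e > 0\<close> by (simp add: dist_norm power_less_imp_less_base)
    qed
    then show "\<exists>M. \<forall>m\<ge>M. \<forall>n>m. dist (lift T m x) (lift T n x) < e" by blast
  qed
  then show ?thesis by (simp add: Cauchy_convergent_iff)
qed

text \<open>Moving \<open>S i\<close> out costs one level. In the limit the shift disappears, which
  is why the limit commutes with \<open>S i\<close>.\<close>

lemma lift_Suc_S: "i < N \<Longrightarrow> x \<in> H \<Longrightarrow> lift T (Suc n) (S i x) = S i (lift T n x)"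
proof -
  assume i: "i < N" and x: "x \<in> H"
  have "lift T n 0 = 0"
    using lift_scaleC[OF closed_csubspaceD(1)[OF closed_H], of n 0] by simp
  then have "lift T (Suc n) (S i x) = (\<Sum>j<N. if j = i then S i (lift T n x) else 0)"
    unfolding lift.simps using i x by (intro sum.cong) (simp_all add: Sa_S S_zero)
  then show ?thesis using i by simp
qed

lemma convergent_lift_S:
  assumes "i < N" "x \<in> H" "convergent (\<lambda>n. lift T n x)"
  shows "convergent (\<lambda>n. lift T n (S i x))"
proof -
  obtain l where l: "(\<lambda>n. lift T n x) \<longlonglongrightarrow> l"
    using assms(3) convergent_def by blast
  have "l \<in> H"
    using closed_csubspace_limit[OF closed_H lift_in[OF assms(2)] l] .
  have "(\<lambda>n. lift T (Suc n) (S i x)) \<longlonglongrightarrow> S i l"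
    unfolding lift_Suc_S[OF assms(1,2)]
    by (rule bounded_op_on_tendsto[OF bounded_S[OF assms(1)] closed_H lift_in[OF assms(2)] l \<open>l \<in> H\<close>])
  then show ?thesis
    by (rule convergentI[OF LIMSEQ_imp_Suc])
qed

lemma closed_csubspace_convergent_lift:
  "closed_csubspace {x \<in> H. convergent (\<lambda>n. lift T n x)}"
proof (rule closed_csubspaceI)
  obtain C where C: "C \<ge> 0" "\<And>x. x \<in> K \<Longrightarrow> norm (T x) \<le> C * norm x"
    using bounded_op_on_bound[OF bounded_T] by metis
  fix f l assume "\<And>n::nat. f n \<in> {x \<in> H. convergent (\<lambda>n. lift T n x)}" and l: "f \<longlonglongrightarrow> l"
  then have f: "\<And>k. f k \<in> H" "\<And>k. Cauchy (\<lambda>n. lift T n (f k))"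
    by (auto simp: Cauchy_convergent_iff)
  have "l \<in> H" using closed_csubspace_limit[OF closed_H f(1) l] .
  have "Cauchy (\<lambda>n. lift T n l)"
  proof (rule CauchyI)
    fix e :: real assume "e > 0"
    \<comment> \<open>\<open>C + 1\<close> keeps the denominator positive when \<open>C\<close> is
      0. Three errors below \<open>e / 4\<close> are added later.\<close>
    then have "e / (4 * (C + 1)) > 0" using C(1) by simp
    then obtain k where "norm (f k - l) < e / (4 * (C + 1))"
      using LIMSEQ_D[OF l] by blast
    then have k: "(C + 1) * norm (f k - l) < e / 4"
      using C(1) by (simp add: field_simps)
    have close: "norm (lift T n (f k) - lift T n l) < e / 4" for n
    proof -
      have "lift T n (f k) - lift T n l = lift T n (f k - l)"
        using lift_add[of "f k - l" l n] f(1) \<open>l \<in> H\<close> closed_csubspaceD(4)[OF closed_H] by simp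
      also have "norm \<dots> \<le> C * norm (f k - l)"
        using f(1) \<open>l \<in> H\<close> by (intro norm_lift C closed_csubspaceD(4)[OF closed_H])
      also have "\<dots> \<le> (C + 1) * norm (f k - l)"
        by (simp add: mult_right_mono)
      finally show ?thesis using k by linarith
    qed
    obtain n0 where n0: "\<And>m n. m \<ge> n0 \<Longrightarrow> n \<ge> n0 \<Longrightarrow> norm (lift T m (f k) - lift T n (f k)) < e / 4"
      using CauchyD[OF f(2)[of k], of "e / 4"] \<open>e > 0\<close> by auto
    have "norm (lift T m l - lift T n l) < e" if "m \<ge> n0" "n \<ge> n0" for m n
    proof -
      have "norm (lift T m l - lift T n l) =
          norm ((lift T m (f k) - lift T n (f k)) - (lift T m (f k) - lift T m l)
            + (lift T n (f k) - lift T n l))"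
        by (simp add: algebra_simps)
      also have "\<dots> \<le> norm (lift T m (f k) - lift T n (f k)) + norm (lift T m (f k) - lift T m l)
            + norm (lift T n (f k) - lift T n l)"
        by (intro order_trans[OF norm_triangle_ineq] add_right_mono norm_triangle_ineq4)
      finally show ?thesis
        using n0[OF that] close[of m] close[of n] \<open>e > 0\<close> by linarith
    qed
    then show "\<exists>M. \<forall>m\<ge>M. \<forall>n\<ge>M. norm (lift T m l - lift T n l) < e" by blast
  qed
  then show "l \<in> {x \<in> H. convergent (\<lambda>n. lift T n x)}"
    using \<open>l \<in> H\<close> by (simp add: Cauchy_convergent_iff)
next
  have "lift T n 0 = 0" for n
    using lift_scaleC[OF closed_csubspaceD(1)[OF closed_H], of n 0] by simp
  then show "0 \<in> {x \<in> H. convergent (\<lambda>n. lift T n x)}"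
    using closed_csubspaceD(1)[OF closed_H] by (simp add: convergent_const)
next
  fix x y assume "x \<in> {x \<in> H. convergent (\<lambda>n. lift T n x)}" "y \<in> {x \<in> H. convergent (\<lambda>n. lift T n x)}"
  then show "x + y \<in> {x \<in> H. convergent (\<lambda>n. lift T n x)}"
    by (simp add: lift_add convergent_add closed_csubspaceD(2)[OF closed_H])
next
  fix a x assume "x \<in> {x \<in> H. convergent (\<lambda>n. lift T n x)}"
  then obtain l where "x \<in> H" "(\<lambda>n. lift T n x) \<longlonglongrightarrow> l"
    by (auto simp: convergent_def)
  moreover from this have "(\<lambda>n. lift T n (a *\<^sub>C x)) \<longlonglongrightarrow> a *\<^sub>C l"
    by (simp add: lift_scaleC scaleC.tendsto[OF tendsto_const])
  ultimately show "a *\<^sub>C x \<in> {x \<in> H. convergent (\<lambda>n. lift T n x)}"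
    using closed_csubspaceD(3)[OF closed_H] by (auto simp: convergent_def)
qed

lemma convergent_lift: "x \<in> H \<Longrightarrow> convergent (\<lambda>n. lift T n x)"
proof -
  assume "x \<in> H"
  have "word_op S w y \<in> {x \<in> H. convergent (\<lambda>n. lift T n x)}" if "w \<in> words N" "y \<in> K" for w y
    using that
    by (induction w) (auto simp: convergent_lift_K K_sub S_in intro: convergent_lift_S)
  then have "closed_span {word_op S w x |w x. w \<in> words N \<and> x \<in> K}
      \<subseteq> {x \<in> H. convergent (\<lambda>n. lift T n x)}"
    by (intro closed_span_minimal closed_csubspace_convergent_lift) blast
  then show ?thesis
    using \<open>x \<in> H\<close> unfolding closed_span_words by blast
qed

lemma ex_commutes_compression:
  "\<exists>B. commutes B \<and> (\<forall>x\<in>K. \<forall>y\<in>K. cinner (B x) y = cinner (T x) y)"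
proof -
  obtain C where C: "C \<ge> 0" "\<And>x. x \<in> K \<Longrightarrow> norm (T x) \<le> C * norm x"
    using bounded_op_on_bound[OF bounded_T] by metis
  define B where "B x = lim (\<lambda>n. lift T n x)" for x
  have lim: "(\<lambda>n. lift T n x) \<longlonglongrightarrow> B x" if "x \<in> H" for x
    using convergent_lift[OF that] unfolding B_def convergent_LIMSEQ_iff .
  have B_in: "B x \<in> H" if "x \<in> H" for x
    using closed_csubspace_limit[OF closed_H lift_in[OF that] lim[OF that]] .
  have add: "B (x + y) = B x + B y" if "x \<in> H" "y \<in> H" for x y
  proof (rule LIMSEQ_unique)
    show "(\<lambda>n. lift T n (x + y)) \<longlonglongrightarrow> B (x + y)"
      using that by (intro lim closed_csubspaceD(2)[OF closed_H])
    show "(\<lambda>n. lift T n (x + y)) \<longlonglongrightarrow> B x + B y"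
      unfolding lift_add[OF that] by (intro tendsto_add lim that)
  qed
  have scale: "B (a *\<^sub>C x) = a *\<^sub>C B x" if "x \<in> H" for a x
  proof (rule LIMSEQ_unique)
    show "(\<lambda>n. lift T n (a *\<^sub>C x)) \<longlonglongrightarrow> B (a *\<^sub>C x)"
      using that by (intro lim closed_csubspaceD(3)[OF closed_H])
    show "(\<lambda>n. lift T n (a *\<^sub>C x)) \<longlonglongrightarrow> a *\<^sub>C B x"
      unfolding lift_scaleC[OF that] by (intro scaleC.tendsto tendsto_const lim that)
  qed
  have "norm (B x) \<le> C * norm x" if "x \<in> H" for x
    using norm_lift[OF C that]
    by (intro LIMSEQ_le_const2[OF tendsto_norm[OF lim[OF that]]]) blast
  then have bounded: "bounded_op_on H B"
    using B_in add scale unfolding bounded_op_on_def by blast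
  have S: "B (S i x) = S i (B x)" if "i < N" "x \<in> H" for i x
  proof (rule LIMSEQ_unique)
    show "(\<lambda>n. lift T (Suc n) (S i x)) \<longlonglongrightarrow> B (S i x)"
      using that by (intro LIMSEQ_Suc lim S_in)
    show "(\<lambda>n. lift T (Suc n) (S i x)) \<longlonglongrightarrow> S i (B x)"
      unfolding lift_Suc_S[OF that]
      using that by (intro bounded_op_on_tendsto[OF bounded_S closed_H] lift_in lim B_in)
  qed
  \<comment> \<open>Expand \<open>x\<close> by the Cuntz relation, move \<open>B\<close> through
    each \<open>S j\<close>, and read off the component with index \<open>i\<close>.\<close>
  have Sa: "B (Sa i x) = Sa i (B x)" if i: "i < N" and x: "x \<in> H" for i x
  proof -
    have "B x = B (\<Sum>j<N. S j (Sa j x))"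
      using x by (simp add: sum_S_Sa)
    also have "\<dots> = (\<Sum>j<N. B (S j (Sa j x)))"
      using x by (intro bounded_op_on_sum[OF bounded closed_H]) (simp add: S_in Sa_in)
    also have "\<dots> = (\<Sum>j<N. S j (B (Sa j x)))"
      using x by (simp add: S Sa_in)
    finally have "Sa i (B x) = Sa i (\<Sum>j<N. S j (B (Sa j x)))" by simp
    also have "\<dots> = B (Sa i x)"
      using i x by (intro Sa_sum_S) (auto simp: B_in Sa_in)
    finally show ?thesis by simp
  qed
  have "cinner (B x) y = cinner (T x) y" if "x \<in> K" "y \<in> K" for x y
    using cinner.tendsto[OF lim[OF K_sub[OF that(1)]] tendsto_const[of y]]
    unfolding cinner_lift[OF that] by (simp add: LIMSEQ_const_iff)
  then show ?thesis
    using bounded S Sa unfolding commutes_def by blast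
qed

end

text \<open>Every fixed point is the compression of some operator in the commutant, so a scalar
  commutant forces scalar fixed points. Conversely, if the compression of \<open>T\<close> is the
  scalar \<open>a\<close>, then \<open>T\<close> minus \<open>a\<close> commutes and has zero
  compression, hence vanishes.\<close>

theorem irreducible_iff_fixed_points_scalar:
  "irreducible_rep N H S \<longleftrightarrow> (\<forall>T. fixed_point T \<longrightarrow> scalar_on K T)"
proof
  assume irr: "irreducible_rep N H S"
  show "\<forall>T. fixed_point T \<longrightarrow> scalar_on K T"
  proof (intro allI impI)
    fix T assume T: "fixed_point T"
    then obtain B where B: "commutes B" "\<And>x y. x \<in> K \<Longrightarrow> y \<in> K \<Longrightarrow> cinner (B x) y = cinner (T x) y"
      using ex_commutes_compression by blast
    obtain a where a: "\<And>x. x \<in> H \<Longrightarrow> B x = a *\<^sub>C x"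
      using irr B(1) unfolding irreducible_rep_iff scalar_on_def by blast
    have "T x = a *\<^sub>C x" if "x \<in> K" for x
      using that B(2)[of x] a[OF K_sub] closed_csubspaceD(3)[OF closed_K] T_in[OF T]
      by (intro eq_if_cinner_eq[OF closed_K]) auto
    then show "scalar_on K T" unfolding scalar_on_def by blast
  qed
next
  assume scalar: "\<forall>T. fixed_point T \<longrightarrow> scalar_on K T"
  show "irreducible_rep N H S"
    unfolding irreducible_rep_iff
  proof (intro allI impI)
    fix T assume T: "commutes T"
    obtain a where a: "\<And>x. x \<in> K \<Longrightarrow> proj_on K (T x) = a *\<^sub>C x"
      using scalar fixed_point_compression[OF T] unfolding scalar_on_def by blast
    have "T x - a *\<^sub>C x = 0" if "x \<in> H" for x
    proof (rule commutes_eq_0[OF commutes_diff_scaleC[OF T] _ that])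
      fix x y assume "x \<in> K" "y \<in> K"
      then show "cinner (T x - a *\<^sub>C x) y = 0"
        using cinner_proj_on[OF closed_K, of y "T x"] a by (simp add: cinner.diff_left)
    qed
    then show "scalar_on H T" unfolding scalar_on_def by (metis eq_iff_diff_eq_0)
  qed
qed

end


section \<open>Random walks\<close>

lemma walk_pt_append: "walk_pt g (v @ w) d = walk_pt g w (walk_pt g v d)"
  by (induction v arbitrary: d) auto

lemma walk_wt_append: "walk_wt g \<nu> (v @ w) d = walk_wt g \<nu> v d * walk_wt g \<nu> w (walk_pt g v d)"
  by (induction v arbitrary: d) auto

locale random_walk = dilation N H S K V
  for N :: nat and H :: "'h::chilbert_space set" and S K V +
  fixes K0 :: "'h set" and M :: "'m set" and g :: "nat \<Rightarrow> 'm \<Rightarrow> 'm" and \<nu> :: "nat \<Rightarrow> 'm \<Rightarrow> complex"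
    and e :: "'m \<Rightarrow> 'h" and c :: 'm
  assumes closed_K0: "closed_csubspace K0" and K0_sub: "K0 \<subseteq> K"
    and acts: "acts_as_random_walk N K V K0 M g \<nu> e"
    and irreducible: "irreducible_walk N M g \<nu>"
    and c_in: "c \<in> M"
begin

abbreviation cyc :: "nat list \<Rightarrow> bool" where "cyc \<equiv> cycle_word N g \<nu> c"
abbreviation \<Omega> :: "nat \<Rightarrow> nat list set" where "\<Omega> \<equiv> cycle_ending_words N g \<nu> c"
abbreviation f :: "nat list \<Rightarrow> 'h" where "f w \<equiv> word_op S w (e c)"
abbreviation Hc :: "nat \<Rightarrow> 'h set" where "Hc n \<equiv> closed_span (f ` \<Omega> n)"
abbreviation W :: "'h set" where "W \<equiv> closed_span (f ` words N)"

lemma finite_M: "finite M"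
  and orthonormal: "orthonormal_basis M e K0"
  and g_in: "i < N \<Longrightarrow> d \<in> M \<Longrightarrow> g i d \<in> M"
  and g_inj: "i < N \<Longrightarrow> d \<in> M \<Longrightarrow> d' \<in> M \<Longrightarrow> \<nu> i d \<noteq> 0 \<Longrightarrow> \<nu> i d' \<noteq> 0 \<Longrightarrow> g i d = g i d' \<Longrightarrow> d = d'"
  using acts unfolding acts_as_random_walk_def by blast+

lemma K0_in_K: "x \<in> K0 \<Longrightarrow> x \<in> K" and K0_in_H: "x \<in> K0 \<Longrightarrow> x \<in> H"
  using K0_sub K_sub by auto

lemma Sa_in_K0: "i < N \<Longrightarrow> x \<in> K0 \<Longrightarrow> Sa i x \<in> K0"
  using acts adj_V K0_sub unfolding acts_as_random_walk_def by (metis subsetD)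

lemma e_in_K0: "d \<in> M \<Longrightarrow> e d \<in> K0"
  using orthonormal closed_span_superset unfolding orthonormal_basis_def by blast

lemmas e_in_K = K0_in_K[OF e_in_K0] and e_in_H = K0_in_H[OF e_in_K0]

lemma cinner_e: "d \<in> M \<Longrightarrow> d' \<in> M \<Longrightarrow> cinner (e d) (e d') = (if d = d' then 1 else 0)"
  using orthonormal unfolding orthonormal_basis_def by blast

lemma norm_e: "d \<in> M \<Longrightarrow> norm (e d) = 1"
  using cinner_e[of d d] unfolding cinner_self by (simp add: norm_eq_1 power2_norm_eq_inner)

lemma Sa_e: "i < N \<Longrightarrow> d \<in> M \<Longrightarrow> Sa i (e d) = \<nu> i d *\<^sub>C e (g i d)"
  using acts adj_V[OF _ e_in_K] unfolding acts_as_random_walk_def by metis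

lemma f_in: "w \<in> words N \<Longrightarrow> f w \<in> H"
  by (rule word_in[OF _ e_in_H[OF c_in]])

text \<open>The isometric column applied to the unit vector \<open>e d\<close>; it lets the walk be
  treated as a Markov chain on \<open>M\<close>.\<close>

lemma sum_prob: "d \<in> M \<Longrightarrow> (\<Sum>i<N. (cmod (\<nu> i d))\<^sup>2) = 1"
proof -
  assume d: "d \<in> M"
  have "(\<Sum>i<N. (cmod (\<nu> i d))\<^sup>2) = (\<Sum>i<N. (norm (Sa i (e d)))\<^sup>2)"
    using d by (intro sum.cong) (auto simp: Sa_e norm_scaleC norm_e g_in)
  then show ?thesis using d by (simp add: sum_norm_Sa e_in_H norm_e)
qed

section \<open>Walks along words and the inner products they determine\<close>

lemma walk_pt_in: "w \<in> words N \<Longrightarrow> d \<in> M \<Longrightarrow> walk_pt g w d \<in> M"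
  by (induction w arbitrary: d) (auto simp: g_in)

text \<open>Along steps of nonzero weight the walk is also deterministic backwards.\<close>

lemma walk_pt_inj:
  assumes "w \<in> words N" "d \<in> M" "d' \<in> M" "walk_wt g \<nu> w d \<noteq> 0" "walk_wt g \<nu> w d' \<noteq> 0"
    and "walk_pt g w d = walk_pt g w d'"
  shows "d = d'"
  using assms
proof (induction w arbitrary: d d')
  case (Cons i w)
  then have "g i d = g i d'" using Cons.IH[of "g i d" "g i d'"] by (simp add: g_in)
  then show ?case using Cons.prems by (auto intro: g_inj)
qed simp

text \<open>Each letter moved to the left factor acts there as one step of the walk.\<close>

lemma cinner_e_word:
  assumes "w \<in> words N" "d \<in> M" "d' \<in> M"
  shows "cinner (e d) (word_op S w (e d')) = (if walk_pt g w d = d' then walk_wt g \<nu> w d else 0)"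
  using assms
proof (induction w arbitrary: d)
  case (Cons i w)
  then have "cinner (e d) (S i (word_op S w (e d'))) = \<nu> i d * cinner (e (g i d)) (word_op S w (e d'))"
    by (simp add: Sa_e cinner_scaleC_left word_in e_in_H flip: cinner_Sa)
  then show ?case using Cons by (simp add: g_in)
qed (simp add: cinner_e)

text \<open>Equal first letters cancel and different ones give orthogonal vectors. When one word is
  exhausted, the rest \<open>u\<close> of the other is a walk from \<open>c\<close> that must return
  to \<open>c\<close>.\<close>

lemma cinner_f_nonzero:
  assumes "v \<in> words N" "w \<in> words N" "cinner (f v) (f w) \<noteq> 0"
  shows "\<exists>u\<in>words N. (w = v @ u \<or> v = w @ u) \<and> walk_pt g u c = c \<and> walk_wt g \<nu> u c \<noteq> 0"
  using assms
proof (induction v arbitrary: w)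
  case Nil
  then show ?case
    using cinner_e_word[OF Nil(2) c_in c_in] by (intro bexI[of _ w]) (auto split: if_splits)
next
  case (Cons i v)
  show ?case
  proof (cases w)
    case Nil
    then have "cinner (e c) (f (i # v)) \<noteq> 0"
      using Cons.prems cinner_eq_0_commute by fastforce
    then show ?thesis
      using cinner_e_word[OF Cons.prems(1) c_in c_in] Cons.prems Nil
      by (intro bexI[of _ "i # v"]) (auto split: if_splits)
  next
    case (Cons j w')
    then have "i = j" "cinner (f v) (f w') \<noteq> 0"
      using Cons.prems by (auto simp: cinner_S_S f_in split: if_splits)
    then show ?thesis
      using Cons.IH[of w'] Cons.prems Cons by auto
  qed
qed

subsection \<open>Cycle words\<close>

lemma cycD:
  assumes "cyc \<beta>"
  shows "\<beta> \<in> words N" "\<beta> \<noteq> []" "walk_pt g \<beta> c = c" "walk_wt g \<nu> \<beta> c \<noteq> 0"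
    and "k + 1 < length \<beta> \<Longrightarrow> walk_pt g (take (k + 1) \<beta>) c \<noteq> c"
  using assms unfolding cycle_word_def by blast+

text \<open>By injectivity of the steps, a walk that follows a cycle word and ends in \<open>c\<close> has started
  in \<open>c\<close>; so a proper suffix of a first return is not a first return.\<close>

lemma cyc_suffix:
  assumes "cyc (\<alpha> @ \<beta>)" "cyc \<beta>"
  shows "\<alpha> = []"
proof (rule ccontr)
  assume ne: "\<alpha> \<noteq> []"
  define d where "d = walk_pt g \<alpha> c"
  note \<alpha>\<beta> = cycD[OF assms(1)] and \<beta> = cycD[OF assms(2)]
  have "d \<in> M" "walk_wt g \<nu> \<beta> d \<noteq> 0" "walk_pt g \<beta> d = walk_pt g \<beta> c"
    using \<alpha>\<beta>(1,3,4) \<beta>(3) c_in unfolding d_def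
    by (auto simp: walk_pt_in walk_wt_append walk_pt_append)
  then have "d = c"
    using walk_pt_inj[OF \<beta>(1)] \<beta>(4) c_in by blast
  \<comment> \<open>The index is written to fit the \<open>k + 1\<close> in
    \<open>cycle_word\<close>; as \<open>\<alpha>\<close> is nonempty it equals
    \<open>length \<alpha>\<close>, so the walk has just read \<open>\<alpha>\<close>.\<close>
  moreover have "walk_pt g (take (length \<alpha> - 1 + 1) (\<alpha> @ \<beta>)) c \<noteq> c"
    using ne \<beta>(2) by (intro \<alpha>\<beta>(5)) (cases \<alpha>; simp)
  ultimately show False using ne by (simp add: d_def)
qed

lemma cyc_suffix_unique:
  assumes "v @ \<beta> = w @ \<gamma>" "cyc \<beta>" "cyc \<gamma>"
  shows "v = w" "\<beta> = \<gamma>"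
proof -
  obtain us where "v = w @ us \<and> us @ \<beta> = \<gamma> \<or> v @ us = w \<and> \<beta> = us @ \<gamma>"
    using assms(1) unfolding append_eq_append_conv2 by blast
  then show "v = w" "\<beta> = \<gamma>"
    using cyc_suffix assms(2,3) by auto
qed

text \<open>Cut the loop at an intermediate visit to \<open>c\<close>. Both pieces are shorter
  loops, with nonzero weights because the weight of the whole is their product.\<close>

lemma loop_eq_concat_cyc:
  assumes "w \<in> words N" "walk_pt g w c = c" "walk_wt g \<nu> w c \<noteq> 0"
  shows "\<exists>\<beta>s. w = concat \<beta>s \<and> (\<forall>\<beta>\<in>set \<beta>s. cyc \<beta>)"
  using assms
proof (induction w rule: length_induct)
  case (1 w)
  consider "w = []" | "cyc w" | "w \<noteq> []" "\<not> cyc w" by blast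
  then show ?case
  proof cases
    case 1
    then show ?thesis by (intro exI[of _ "[]"]) simp
  next
    case 2
    then show ?thesis by (intro exI[of _ "[w]"]) simp
  next
    case 3
    then obtain k where k: "k + 1 < length w" "walk_pt g (take (k + 1) w) c = c"
      using 1 unfolding cycle_word_def by blast
    define u v where "u = take (k + 1) w" and "v = drop (k + 1) w"
    have uv: "w = u @ v" "length u < length w" "length v < length w"
      using k(1) by (auto simp: u_def v_def)
    have c: "walk_pt g u c = c"
      using k(2) by (simp add: u_def)
    have loops: "walk_pt g v c = c" "walk_wt g \<nu> u c \<noteq> 0" "walk_wt g \<nu> v c \<noteq> 0"
        "u \<in> words N" "v \<in> words N"
      using "1.prems" c unfolding uv(1) by (auto simp: walk_pt_append walk_wt_append)
    obtain \<beta>s \<gamma>s where "u = concat \<beta>s" "v = concat \<gamma>s" "\<forall>\<beta>\<in>set \<beta>s. cyc \<beta>" "\<forall>\<beta>\<in>set \<gamma>s. cyc \<beta>"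
      using "1.IH" uv(2,3) c loops by metis
    then show ?thesis
      unfolding uv(1) by (intro exI[of _ "\<beta>s @ \<gamma>s"]) auto
  qed
qed

section \<open>Words graded by the number of terminal cycle words\<close>

lemma \<Omega>_0: "\<Omega> 0 = {w \<in> words N. \<not> (\<exists>v \<beta>. cyc \<beta> \<and> w = v @ \<beta>)}"
  unfolding cycle_ending_words_def cycle_free_words_def by simp

text \<open>A recursion at the right end, where cycle words are read off uniquely; the inductions
  over the grading use this form.\<close>

lemma \<Omega>_Suc: "\<Omega> (Suc n) = {w @ \<beta> |w \<beta>. w \<in> \<Omega> n \<and> cyc \<beta>}"
proof (intro equalityI subsetI)
  fix u assume "u \<in> \<Omega> (Suc n)"
  then obtain w \<beta>s where u: "u = w @ concat \<beta>s" "w \<in> cycle_free_words N g \<nu> c"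
      "length \<beta>s = Suc n" "\<forall>\<beta>\<in>set \<beta>s. cyc \<beta>"
    unfolding cycle_ending_words_def by blast
  then obtain \<gamma>s \<beta> where "\<beta>s = \<gamma>s @ [\<beta>]" "length \<gamma>s = n"
    by (metis length_Suc_conv_rev)
  then have "u = (w @ concat \<gamma>s) @ \<beta>" "w @ concat \<gamma>s \<in> \<Omega> n" "cyc \<beta>"
    using u unfolding cycle_ending_words_def by auto
  then show "u \<in> {w @ \<beta> |w \<beta>. w \<in> \<Omega> n \<and> cyc \<beta>}" by blast
next
  fix u assume "u \<in> {w @ \<beta> |w \<beta>. w \<in> \<Omega> n \<and> cyc \<beta>}"
  then obtain w \<beta>s \<beta> where u: "u = (w @ concat \<beta>s) @ \<beta>" "w \<in> cycle_free_words N g \<nu> c"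
      "length \<beta>s = n" "\<forall>\<beta>\<in>set \<beta>s. cyc \<beta>" "cyc \<beta>"
    unfolding cycle_ending_words_def by blast
  then have "u = w @ concat (\<beta>s @ [\<beta>])" "length (\<beta>s @ [\<beta>]) = Suc n" "\<forall>\<gamma>\<in>set (\<beta>s @ [\<beta>]). cyc \<gamma>"
    by auto
  then show "u \<in> \<Omega> (Suc n)"
    using u(2) unfolding cycle_ending_words_def by blast
qed

lemma \<Omega>_words: "w \<in> \<Omega> n \<Longrightarrow> w \<in> words N"
  by (induction n arbitrary: w) (auto simp: \<Omega>_0 \<Omega>_Suc cycD)

lemma \<Omega>_append: "w \<in> \<Omega> n \<Longrightarrow> (\<forall>\<beta>\<in>set \<beta>s. cyc \<beta>) \<Longrightarrow> w @ concat \<beta>s \<in> \<Omega> (n + length \<beta>s)"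
proof (induction \<beta>s arbitrary: w n)
  case (Cons \<beta> \<beta>s)
  then have "w @ \<beta> \<in> \<Omega> (Suc n)" unfolding \<Omega>_Suc by auto
  then show ?case using Cons.IH[of "w @ \<beta>" "Suc n"] Cons.prems(2) by simp
qed simp

text \<open>The last cycle word of a word is unique, so two factorizations can be shortened
  together.\<close>

lemma \<Omega>_disjoint: "w \<in> \<Omega> m \<Longrightarrow> w \<in> \<Omega> n \<Longrightarrow> m = n"
proof (induction m arbitrary: w n)
  case 0
  then show ?case by (cases n) (auto simp: \<Omega>_0 \<Omega>_Suc)
next
  case (Suc m)
  then obtain v \<beta> where v: "w = v @ \<beta>" "v \<in> \<Omega> m" "cyc \<beta>" unfolding \<Omega>_Suc by blast
  then obtain k where n: "n = Suc k" using Suc.prems(2) by (cases n) (auto simp: \<Omega>_0)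
  then obtain v' \<gamma> where v': "w = v' @ \<gamma>" "v' \<in> \<Omega> k" "cyc \<gamma>"
    using Suc.prems(2) unfolding n \<Omega>_Suc by blast
  have "v = v'" using cyc_suffix_unique(1)[of v \<beta> v' \<gamma>] v v' by auto
  then show ?case using Suc.IH[of v k] v(2) v'(2) n by simp
qed

text \<open>Strip terminal cycle words until none is left; this ends because they are
  nonempty.\<close>

lemma UN_\<Omega>: "(\<Union>n. \<Omega> n) = words N"
proof (intro equalityI subsetI)
  fix w assume "w \<in> words N"
  then show "w \<in> (\<Union>n. \<Omega> n)"
  proof (induction w rule: length_induct)
    case (1 w)
    show ?case
    proof (cases "w \<in> \<Omega> 0")
      case False
      then obtain v \<beta> where v: "cyc \<beta>" "w = v @ \<beta>" using 1 unfolding \<Omega>_0 by blast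
      then have "v \<in> words N" "length v < length w" using 1 cycD(2) by auto
      then obtain n where "v \<in> \<Omega> n" using 1 by blast
      then have "w \<in> \<Omega> (Suc n)" using v unfolding \<Omega>_Suc by blast
      then show ?thesis by blast
    qed blast
  qed
qed (use \<Omega>_words in blast)

lemma orthonormal_\<Omega>:
  assumes "v \<in> \<Omega> n" "w \<in> \<Omega> n"
  shows "cinner (f v) (f w) = (if v = w then 1 else 0)"
proof (cases "v = w")
  case True
  then show ?thesis
    using \<Omega>_words[OF assms(1)] by (simp add: cinner_word_word e_in_H c_in cinner_e)
next
  case False
  have "cinner (f v) (f w) = 0"
  proof (rule ccontr)
    assume "cinner (f v) (f w) \<noteq> 0"
    then obtain u where u: "w = v @ u \<or> v = w @ u" "u \<in> words N" "walk_pt g u c = c" "walk_wt g \<nu> u c \<noteq> 0"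
      using cinner_f_nonzero \<Omega>_words assms by blast
    obtain \<beta>s where \<beta>s: "u = concat \<beta>s" "\<forall>\<beta>\<in>set \<beta>s. cyc \<beta>"
      using loop_eq_concat_cyc[OF u(2-4)] by blast
    have "v @ u \<in> \<Omega> (n + length \<beta>s)" "w @ u \<in> \<Omega> (n + length \<beta>s)"
      using \<Omega>_append assms \<beta>s by auto
    \<comment> \<open>One of \<open>v\<close>, \<open>w\<close> is the other with \<open>u\<close>
      appended, so it lies in both classes. Hence \<open>u\<close> has no cycle factors and is
      empty.\<close>
    then have "n + length \<beta>s = n"
      using u(1) assms \<Omega>_disjoint by metis
    then show False using u(1) \<beta>s(1) False by simp
  qed
  then show ?thesis using False by simp
qed

lemma orthonormal_basis_Hc: "orthonormal_basis (\<Omega> n) f (Hc n)"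
  unfolding orthonormal_basis_def using orthonormal_\<Omega> by blast

subsection \<open>Recurrence\<close>

text \<open>First-passage words to \<open>c\<close>. The starting point is free, so that one can
  induct on the first step and also reach the vectors \<open>e d\<close> with
  \<open>d \<noteq> c\<close>.\<close>

definition hit_word :: "'m \<Rightarrow> nat list \<Rightarrow> bool" where
  "hit_word d \<beta> \<longleftrightarrow> \<beta> \<in> words N \<and> \<beta> \<noteq> [] \<and> walk_pt g \<beta> d = c \<and> walk_wt g \<nu> \<beta> d \<noteq> 0 \<and>
     (\<forall>k. k + 1 < length \<beta> \<longrightarrow> walk_pt g (take (k + 1) \<beta>) d \<noteq> c)"

lemma hit_word_c: "hit_word c = cyc"
  unfolding hit_word_def cycle_word_def by (rule ext) (rule refl)

lemma hit_word_single: "i < N \<Longrightarrow> \<nu> i d \<noteq> 0 \<Longrightarrow> g i d = c \<Longrightarrow> hit_word d [i]"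
  unfolding hit_word_def by simp

lemma hit_word_Cons:
  assumes "i < N" "\<nu> i d \<noteq> 0" "g i d \<noteq> c" "hit_word (g i d) \<beta>"
  shows "hit_word d (i # \<beta>)"
proof -
  have "walk_pt g (take (k + 1) (i # \<beta>)) d \<noteq> c" if "k + 1 < length (i # \<beta>)" for k
    using assms that unfolding hit_word_def by (cases k) auto
  then show ?thesis using assms unfolding hit_word_def by auto
qed

text \<open>The part of \<open>e\<^sub>d\<close> carried by the walks of length \<open>n\<close> from \<open>d\<close> that have not visited \<open>c\<close> after
  time 0; its squared norm is the probability of such a walk.\<close>

primrec miss :: "nat \<Rightarrow> 'm \<Rightarrow> 'h" where
  "miss 0 d = e d"
| "miss (Suc n) d = (\<Sum>i<N. S i (if g i d = c then 0 else \<nu> i d *\<^sub>C miss n (g i d)))"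

lemma miss_in: "d \<in> M \<Longrightarrow> miss n d \<in> H"
  by (induction n arbitrary: d)
    (auto simp: e_in_H g_in closed_csubspaceD(1,3)[OF closed_H] intro!: sum_S_in)

text \<open>Split off the first step. A branch of weight 0 contributes nothing, a branch into
  \<open>c\<close> contributes a multiple of \<open>f [i]\<close>, and on any other branch
  \<open>S i\<close> prefixes the letter \<open>i\<close> to the first-passage words of the
  induction hypothesis.\<close>

lemma e_diff_miss_in:
  "d \<in> M \<Longrightarrow> e d - miss n d \<in> closed_span (f ` Collect (hit_word d))"
proof (induction n arbitrary: d)
  case 0
  then show ?case by (simp add: closed_csubspaceD(1))
next
  case (Suc n)
  let ?G = "\<lambda>d. closed_span (f ` Collect (hit_word d))"
  define y where "y i = \<nu> i d *\<^sub>C e (g i d) - (if g i d = c then 0 else \<nu> i d *\<^sub>C miss n (g i d))" for i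
  have "e d - miss (Suc n) d = (\<Sum>i<N. S i (Sa i (e d))) - miss (Suc n) d"
    using Suc.prems by (simp add: sum_S_Sa e_in_H)
  also have "\<dots> = (\<Sum>i<N. S i (y i))"
    unfolding y_def miss.simps sum_subtractf[symmetric] using Suc.prems
    by (intro sum.cong refl)
      (simp add: Sa_e S_diff e_in_H g_in miss_in closed_csubspaceD(1,3)[OF closed_H])
  also have "\<dots> \<in> ?G d"
  proof (rule closed_csubspaceD(6)[OF closed_csubspace_closed_span])
    fix i assume "i \<in> {..<N}"
    then have i: "i < N" by simp
    consider "\<nu> i d = 0" | "\<nu> i d \<noteq> 0" "g i d = c" | "\<nu> i d \<noteq> 0" "g i d \<noteq> c" by blast
    then show "S i (y i) \<in> ?G d"
    proof cases
      case 1
      then have "S i (y i) = 0" using i by (simp add: y_def scaleC.zero_left S_zero)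
      then show ?thesis by (simp add: closed_csubspaceD(1))
    next
      case 2
      then have "f [i] \<in> ?G d" using hit_word_single[OF i] by (intro closed_span_base) blast
      then show ?thesis
        using 2 i by (simp add: y_def S_scaleC e_in_H c_in closed_csubspaceD(3))
    next
      case 3
      let ?d = "g i d"
      have d: "?d \<in> M" using i Suc.prems by (rule g_in)
      have "S i (e ?d - miss n ?d) \<in> ?G d"
      proof (rule bounded_op_on_closed_span[OF bounded_S[OF i] closed_H _ _ Suc.IH[OF d]])
        fix x assume "x \<in> f ` Collect (hit_word ?d)"
        then obtain \<beta> where \<beta>: "x = f \<beta>" "hit_word ?d \<beta>" by blast
        then have "f (i # \<beta>) \<in> ?G d"
          using hit_word_Cons[OF i 3] by (intro closed_span_base) blast
        moreover have "x \<in> H" using \<beta> by (auto simp: hit_word_def f_in)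
        ultimately show "x \<in> H \<and> S i x \<in> ?G d" using \<beta>(1) by simp
      qed simp
      moreover have "S i (y i) = \<nu> i d *\<^sub>C S i (e ?d - miss n ?d)"
        using 3 i d by (simp add: y_def scaleC.diff_right[symmetric] S_scaleC e_in_H miss_in
            closed_csubspaceD(4)[OF closed_H])
      ultimately show ?thesis by (simp add: closed_csubspaceD(3))
    qed
  qed
  finally show ?case .
qed

lemma norm_miss_Suc:
  assumes d: "d \<in> M"
  shows "(norm (miss (Suc n) d))\<^sup>2
    = (\<Sum>i<N. (cmod (\<nu> i d))\<^sup>2 * (if g i d = c then 0 else (norm (miss n (g i d)))\<^sup>2))"
proof -
  have "(norm (miss (Suc n) d))\<^sup>2
      = (\<Sum>i<N. (norm (if g i d = c then 0 else \<nu> i d *\<^sub>C miss n (g i d)))\<^sup>2)"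
    unfolding miss.simps using d
    by (intro norm_sum_S) (simp add: miss_in g_in closed_csubspaceD(1,3)[OF closed_H])
  also have "\<dots> = (\<Sum>i<N. (cmod (\<nu> i d))\<^sup>2 * (if g i d = c then 0 else (norm (miss n (g i d)))\<^sup>2))"
    by (intro sum.cong) (auto simp: norm_scaleC power_mult_distrib)
  finally show ?thesis .
qed

lemma decseq_norm_miss: "d \<in> M \<Longrightarrow> (norm (miss (Suc n) d))\<^sup>2 \<le> (norm (miss n d))\<^sup>2"
proof (induction n arbitrary: d)
  case 0
  have "(norm (miss (Suc 0) d))\<^sup>2 \<le> (\<Sum>i<N. (cmod (\<nu> i d))\<^sup>2 * 1)"
    unfolding norm_miss_Suc[OF 0] using 0 by (intro sum_mono mult_left_mono) (auto simp: norm_e g_in)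
  then show ?case using 0 by (simp add: sum_prob norm_e del: miss.simps(2))
next
  case (Suc n)
  show ?case
    unfolding norm_miss_Suc[OF Suc.prems, of "Suc n"] norm_miss_Suc[OF Suc.prems, of n]
    using Suc by (intro sum_mono mult_left_mono) (auto simp: g_in simp del: miss.simps)
qed

text \<open>A positive maximum of the limiting non-return probability would propagate along all walks and
  prevent them from reaching \<open>c\<close>, against irreducibility.\<close>

lemma miss_tendsto_0:
  assumes "d \<in> M"
  shows "(\<lambda>n. miss n d) \<longlonglongrightarrow> 0"
proof -
  define q where "q d = lim (\<lambda>n. (norm (miss n d))\<^sup>2)" for d
  have q: "(\<lambda>n. (norm (miss n d))\<^sup>2) \<longlonglongrightarrow> q d" if "d \<in> M" for d
  proof -
    have "decseq (\<lambda>n. (norm (miss n d))\<^sup>2)"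
      using decseq_norm_miss[OF that] by (rule decseq_SucI)
    then have "convergent (\<lambda>n. (norm (miss n d))\<^sup>2)"
      using decseq_convergent[of "\<lambda>n. (norm (miss n d))\<^sup>2" 0] zero_le_power2 convergentI by metis
    then show ?thesis unfolding q_def convergent_LIMSEQ_iff .
  qed
  have q_nonneg: "q d \<ge> 0" if "d \<in> M" for d
    by (rule LIMSEQ_le_const[OF q[OF that]]) auto
  \<comment> \<open>The limit of the first-step equation \<open>norm_miss_Suc\<close>; steps into
    \<open>c\<close> contribute 0.\<close>
  have harmonic: "q d = (\<Sum>i<N. (cmod (\<nu> i d))\<^sup>2 * (if g i d = c then 0 else q (g i d)))"
    if d: "d \<in> M" for d
  proof (rule LIMSEQ_unique[OF LIMSEQ_Suc[OF q[OF d]]])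
    have "(\<lambda>n. if g i d = c then 0 else (norm (miss n (g i d)))\<^sup>2)
        \<longlonglongrightarrow> (if g i d = c then 0 else q (g i d))" if "i < N" for i
      using q[OF g_in[OF that d]] by (cases "g i d = c") simp_all
    then show "(\<lambda>n. (norm (miss (Suc n) d))\<^sup>2)
        \<longlonglongrightarrow> (\<Sum>i<N. (cmod (\<nu> i d))\<^sup>2 * (if g i d = c then 0 else q (g i d)))"
      unfolding norm_miss_Suc[OF d] by (intro tendsto_sum tendsto_mult tendsto_const) simp
  qed
  define m where "m = Max (q ` M)"
  have q_le: "q d \<le> m" if "d \<in> M" for d
    unfolding m_def using finite_M that by simp
  have "m \<in> q ` M"
    unfolding m_def using finite_M c_in by (intro Max_in) auto
  then obtain d0 where d0: "d0 \<in> M" "q d0 = m" by blast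
  have "m \<le> 0"
  proof (rule ccontr)
    assume "\<not> m \<le> 0"
    have step: "g i d \<noteq> c \<and> q (g i d) = m" if d: "d \<in> M" "q d = m" and i: "i < N" "\<nu> i d \<noteq> 0" for d i
    proof -
      let ?r = "\<lambda>i. if g i d = c then 0 else q (g i d)"
      \<comment> \<open>As \<open>q d\<close> is the maximum, this sum of nonnegative terms
        vanishes. So each step of positive probability avoids \<open>c\<close> and again attains the
        maximum.\<close>
      have "(\<Sum>i<N. (cmod (\<nu> i d))\<^sup>2 * (m - ?r i)) = m * (\<Sum>i<N. (cmod (\<nu> i d))\<^sup>2) - q d"
        unfolding harmonic[OF d(1)] by (simp add: right_diff_distrib sum_subtractf sum_distrib_left mult.commute)
      also have "\<dots> = 0" using d by (simp add: sum_prob)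
      finally have "(cmod (\<nu> i d))\<^sup>2 * (m - ?r i) = 0"
        using i(1) q_le g_in[OF _ d(1)] \<open>\<not> m \<le> 0\<close>
        by (subst (asm) sum_nonneg_eq_0_iff) auto
      then show ?thesis using i(2) \<open>\<not> m \<le> 0\<close> by (auto split: if_splits)
    qed
    have avoid: "walk_pt g w d \<noteq> c"
      if "w \<in> words N" "d \<in> M" "q d = m" "walk_wt g \<nu> w d \<noteq> 0" "d \<noteq> c" for w d
      using that by (induction w arbitrary: d) (auto simp: g_in step)
    \<comment> \<open>The point \<open>d0\<close> may be \<open>c\<close> itself, so one step is
      taken first: \<open>step\<close> then yields a point other than \<open>c\<close>, from which
      irreducibility still leads to \<open>c\<close>.\<close>
    obtain i where i: "i < N" "\<nu> i d0 \<noteq> 0"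
      using sum_prob[OF d0(1)] by (metis (no_types, lifting) lessThan_iff norm_zero sum.neutral
          zero_neq_one zero_power2)
    obtain w where "w \<in> words N" "walk_pt g w (g i d0) = c" "walk_wt g \<nu> w (g i d0) \<noteq> 0"
      using irreducible g_in[OF i(1) d0(1)] c_in unfolding irreducible_walk_def by blast
    then show False
      using avoid[of w "g i d0"] step[OF d0 i] g_in[OF i(1) d0(1)] by blast
  qed
  then have "q d = 0"
    using q_le[OF assms] q_nonneg[OF assms] by linarith
  then have "(\<lambda>n. (norm (miss n d))\<^sup>2) \<longlonglongrightarrow> 0"
    using q[OF assms] by simp
  then have "(\<lambda>n. sqrt ((norm (miss n d))\<^sup>2)) \<longlonglongrightarrow> sqrt 0"
    by (rule tendsto_real_sqrt)
  then show ?thesis by (simp add: tendsto_norm_zero_iff)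
qed

lemma e_in_closed_span_hits:
  assumes "d \<in> M"
  shows "e d \<in> closed_span (f ` Collect (hit_word d))"
proof (rule closed_csubspace_limit[OF closed_csubspace_closed_span e_diff_miss_in[OF assms]])
  show "(\<lambda>n. e d - miss n d) \<longlonglongrightarrow> e d"
    using tendsto_diff[OF tendsto_const miss_tendsto_0[OF assms], of "e d"] by simp
qed

lemma f_in_closed_span_cycles:
  assumes "w \<in> words N"
  shows "f w \<in> closed_span ((\<lambda>\<beta>. f (w @ \<beta>)) ` Collect cyc)"
proof -
  have "e c \<in> closed_span (f ` Collect cyc)"
    using e_in_closed_span_hits[OF c_in] by (simp add: hit_word_c)
  then show ?thesis
  proof (rule bounded_op_on_closed_span[OF bounded_word[OF assms] closed_H, rotated -1])
    fix x assume "x \<in> f ` Collect cyc"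
    then show "x \<in> H \<and> word_op S w x \<in> closed_span ((\<lambda>\<beta>. f (w @ \<beta>)) ` Collect cyc)"
      using f_in cycD(1) by (auto simp flip: word_op_append intro!: closed_span_base)
  qed simp
qed

section \<open>The increasing chain of subspaces and the invariant subspace \<open>W\<close>\<close>

lemma Hc_Suc: "Hc n \<subseteq> Hc (Suc n)"
proof (rule closed_span_mono, clarify)
  fix w assume w: "w \<in> \<Omega> n"
  have "(\<lambda>\<beta>. f (w @ \<beta>)) ` Collect cyc \<subseteq> f ` \<Omega> (Suc n)"
    using w unfolding \<Omega>_Suc by blast
  then have "closed_span ((\<lambda>\<beta>. f (w @ \<beta>)) ` Collect cyc) \<subseteq> Hc (Suc n)"
    by (intro closed_span_mono order_trans[OF _ closed_span_superset])
  then show "f w \<in> Hc (Suc n)"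
    using f_in_closed_span_cycles[OF \<Omega>_words[OF w]] by (rule subsetD)
qed

lemma Hc_mono: "m \<le> n \<Longrightarrow> Hc m \<subseteq> Hc n"
  by (rule lift_Suc_mono_le[of Hc]) (rule Hc_Suc)

lemma Hc_sub_W: "Hc n \<subseteq> W"
  using \<Omega>_words by (intro closed_span_mono order_trans[OF image_mono closed_span_superset] subsetI)

lemma W_eq: "W = closure (\<Union>n. Hc n)"
proof
  have sub: "csubspace (Hc n)" for n
    using closed_csubspace_closed_span unfolding closed_csubspace_def by blast
  \<comment> \<open>Sums stay in the union because the chain is nested.\<close>
  have "csubspace (\<Union>n. Hc n)"
    unfolding complex_vector.subspace_def
  proof (intro conjI ballI allI)
    show "0 \<in> (\<Union>n. Hc n)"
      using complex_vector.subspace_0[OF sub] by blast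
    fix x assume "x \<in> (\<Union>n. Hc n)"
    then obtain m where m: "x \<in> Hc m" by blast
    show "a *\<^sub>C x \<in> (\<Union>n. Hc n)" for a
      using complex_vector.subspace_scale[OF sub m] by blast
    fix y assume "y \<in> (\<Union>n. Hc n)"
    then obtain n where n: "y \<in> Hc n" by blast
    have "x \<in> Hc (max m n)" "y \<in> Hc (max m n)"
      using m n Hc_mono[of m "max m n"] Hc_mono[of n "max m n"] by auto
    then show "x + y \<in> (\<Union>n. Hc n)"
      using complex_vector.subspace_add[OF sub] by blast
  qed
  moreover have "f ` words N \<subseteq> closure (\<Union>n. Hc n)"
    unfolding UN_\<Omega>[symmetric] image_UN
    by (intro order_trans[OF UN_mono closure_subset] closed_span_superset order_refl)
  ultimately show "W \<subseteq> closure (\<Union>n. Hc n)"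
    by (intro closed_span_minimal closed_csubspace_closure)
  show "closure (\<Union>n. Hc n) \<subseteq> W"
    using Hc_sub_W closed_csubspace_closed_span[of "f ` words N"] unfolding closed_csubspace_def
    by (intro closure_minimal) blast+
qed

text \<open>Recurrence from an arbitrary starting point expands \<open>e d\<close> over
  first-passage words to \<open>c\<close>. This brings all of \<open>K0\<close> into
  \<open>W\<close>.\<close>

lemma e_in_W: "d \<in> M \<Longrightarrow> e d \<in> W"
proof -
  assume "d \<in> M"
  have "closed_span (f ` Collect (hit_word d)) \<subseteq> W"
    by (intro closed_span_mono order_trans[OF image_mono closed_span_superset])
      (auto simp: hit_word_def)
  then show ?thesis using e_in_closed_span_hits[OF \<open>d \<in> M\<close>] by blast
qed

lemma K0_sub_W: "K0 \<subseteq> W"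
  using orthonormal e_in_W unfolding orthonormal_basis_def
  by (metis closed_csubspace_closed_span closed_span_minimal image_subsetI)

lemma invariant_W: "invariant W"
proof (rule closed_span_invariant)
  show "f ` words N \<subseteq> H" using f_in by blast
  fix i x assume i: "i < N" and "x \<in> f ` words N"
  then obtain w where w: "x = f w" "w \<in> words N" by blast
  have "f (i # w) \<in> W" using i w by (intro closed_span_base) (auto intro!: image_eqI[of _ _ "i # w"])
  moreover have "Sa i x \<in> W"
  proof (cases w)
    case Nil
    \<comment> \<open>With no letter to cancel, \<open>Sa i\<close> moves \<open>e c\<close> to a
      multiple of \<open>e (g i c)\<close>, which lies in \<open>W\<close> by recurrence.\<close>
    then show ?thesis
      using w i e_in_W g_in c_in by (simp add: Sa_e closed_csubspaceD(3))
  next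
    case (Cons j v)
    then have "f v \<in> W" using w by (intro closed_span_base) auto
    then show ?thesis
      using Cons w i by (simp add: Sa_S f_in closed_csubspaceD(1))
  qed
  ultimately show "S i x \<in> W \<and> Sa i x \<in> W" using w(1) by simp
qed

lemma adj_W: "i < N \<Longrightarrow> x \<in> W \<Longrightarrow> adj_on W (S i) x = Sa i x"
  by (rule adj_on_invariant[OF invariant_W])

subsection \<open>The subrepresentation generated by the walk\<close>

abbreviation V0 :: "nat \<Rightarrow> 'h \<Rightarrow> 'h" where
  "V0 \<equiv> \<lambda>i x. proj_on K0 (V i (proj_on K0 x))"

lemma bounded_V0: "i < N \<Longrightarrow> bounded_op_on K0 (V0 i)"
  using bounded_op_on_proj_on_comp[OF bounded_V closed_K0 K0_sub] unfolding bounded_op_on_def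
  by (simp add: proj_on_id[OF closed_K0] closed_csubspaceD(2,3)[OF closed_K0])

lemma adj_V0: "i < N \<Longrightarrow> x \<in> K0 \<Longrightarrow> adj_on K0 (V0 i) x = Sa i x"
  by (rule adj_on_eqI[OF closed_K0])
    (simp_all add: Sa_in_K0 cinner_proj_on[OF closed_K0] proj_on_id[OF closed_K0] cinner_V K0_in_K)

lemma row_coisometry_V0: "row_coisometry N K0 V0"
proof -
  have "(\<Sum>i<N. V0 i (Sa i x)) = x" if x: "x \<in> K0" for x
  proof (rule eq_if_cinner_eq[OF closed_K0])
    fix z assume z: "z \<in> K0"
    have "cinner (\<Sum>i<N. V0 i (Sa i x)) z = (\<Sum>i<N. cinner (Sa i x) (Sa i z))"
      using x z by (simp add: cinner.sum_left cinner_proj_on[OF closed_K0] proj_on_id[OF closed_K0]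
          Sa_in_K0 cinner_V K0_in_K)
    also have "\<dots> = cinner (\<Sum>i<N. S i (Sa i x)) z"
      using x by (simp add: cinner_sum_S_left Sa_in K0_in_H)
    finally show "cinner (\<Sum>i<N. V0 i (Sa i x)) z = cinner x z"
      using x by (simp add: sum_S_Sa K0_in_H)
  qed (use x in \<open>auto intro!: closed_csubspaceD(6)[OF closed_K0] proj_on_in[OF closed_K0]\<close>)
  then show ?thesis
    unfolding row_coisometry_def using closed_K0 bounded_V0 adj_V0 by simp
qed

lemma cyclic_W: "cyclic_for N W S K0"
proof -
  let ?D = "{star_word_op W S w x |w x. w \<in> lists ({..<N} \<times> UNIV) \<and> x \<in> K0}"
  have "star_word_op W S w x \<in> W" if "w \<in> lists ({..<N} \<times> UNIV)" "x \<in> K0" for w x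
    using that
  proof (induction w)
    case Nil
    then show ?case using K0_sub_W by auto
  next
    case (Cons a w)
    then show ?case
      using invariant_W unfolding invariant_def by (cases a) (auto simp: adj_W)
  qed
  then have "closed_span ?D \<subseteq> W"
    by (intro closed_span_minimal) auto
  moreover have "f w \<in> ?D" if "w \<in> words N" for w
  proof (intro CollectI exI conjI)
    \<comment> \<open>Words without adjoint letters already give all generators of
      \<open>W\<close>.\<close>
    show "f w = star_word_op W S (map (\<lambda>i. (i, False)) w) (e c)"
      by (induction w) auto
    show "map (\<lambda>i. (i, False)) w \<in> lists ({..<N} \<times> UNIV)"
      using that by (auto simp: words_def lists_eq_set)
  qed (rule e_in_K0[OF c_in])
  then have "f ` words N \<subseteq> ?D"
    by (rule image_subsetI)
  then have "W \<subseteq> closed_span ?D"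
    by (intro closed_span_mono order_trans[OF _ closed_span_superset])
  ultimately show ?thesis unfolding cyclic_for_def by blast
qed

lemma cuntz_dilation_W: "cuntz_dilation N K0 V0 W S"
  unfolding cuntz_dilation_def
proof (intro conjI allI impI ballI)
  fix i x assume "i < N" "x \<in> K0"
  then show "adj_on W (S i) x \<in> K0" "adj_on K0 (V0 i) x = adj_on W (S i) x"
    using K0_sub_W by (auto simp: adj_W Sa_in_K0 adj_V0)
qed (simp_all only: row_coisometry_V0 cuntz_rep_invariant[OF invariant_W] K0_sub_W cyclic_W)

text \<open>Since the projection passes through the sum, the fixed points belonging to
  \<open>V0\<close> are exactly the operators in the definition of simplicity. The fixed point
  criterion is applied to \<open>W\<close> as a dilation of \<open>K0\<close>.\<close>

lemma irreducible_rep_W: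
  assumes "simple_on N K V K0"
  shows "irreducible_rep N W S"
proof -
  interpret W: dilation N W S K0 V0
    by unfold_locales (simp_all add: cuntz_rep_invariant[OF invariant_W] cuntz_dilation_W)
  have "scalar_on K0 T" if T: "W.fixed_point T" for T
  proof -
    have bT: "bounded_op_on K0 T" and fixed: "\<And>x. x \<in> K0 \<Longrightarrow> (\<Sum>i<N. V0 i (T (W.Sa i x))) = T x"
      using T unfolding W.fixed_point_def by auto
    have "proj_on K0 (\<Sum>i<N. V i (T (adj_on K (V i) (proj_on K0 x)))) = T x" if x: "x \<in> K0" for x
    proof -
      have "proj_on K0 (\<Sum>i<N. V i (T (adj_on K (V i) (proj_on K0 x))))
          = (\<Sum>i<N. V0 i (T (W.Sa i x)))"
        unfolding proj_on_sum[OF closed_K0]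
      proof (intro sum.cong refl)
        fix i assume "i \<in> {..<N}"
        then have i: "i < N" by simp
        then have "adj_on K (V i) (proj_on K0 x) = Sa i x" "W.Sa i x = Sa i x" "T (Sa i x) \<in> K0"
          using x K0_sub_W bounded_op_onD(1)[OF bT]
          by (auto simp: proj_on_id[OF closed_K0] adj_V K0_in_K adj_W Sa_in_K0)
        then show "proj_on K0 (V i (T (adj_on K (V i) (proj_on K0 x)))) = V0 i (T (W.Sa i x))"
          by (simp add: proj_on_id[OF closed_K0])
      qed
      then show ?thesis using fixed[OF x] by simp
    qed
    then show ?thesis using assms bT unfolding simple_on_def by blast
  qed
  then show ?thesis unfolding W.irreducible_iff_fixed_points_scalar by blast
qed

text \<open>The projection onto \<open>W\<close> lies in the commutant, so irreducibility makes it a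
  scalar; the scalar is 1 because \<open>e c\<close> is fixed. The other direction is
  \<open>irreducible_rep_W\<close>.\<close>

lemma W_eq_H_iff:
  assumes "simple_on N K V K0"
  shows "W = H \<longleftrightarrow> irreducible_rep N H S"
proof
  assume "W = H"
  then show "irreducible_rep N H S" using irreducible_rep_W[OF assms] by simp
next
  assume "irreducible_rep N H S"
  then obtain a where a: "\<And>x. x \<in> H \<Longrightarrow> proj_on W x = a *\<^sub>C x"
    using commutes_proj_on[OF invariant_W] unfolding irreducible_rep_iff scalar_on_def by blast
  have "e c = a *\<^sub>C e c"
    using a[OF e_in_H[OF c_in]] by (simp add: proj_on_id e_in_W c_in)
  then have "cinner (e c) (e c) = a * cinner (e c) (e c)"
    using cinner_scaleC_left[of a "e c" "e c"] by simp
  then have "a = 1" by (simp add: cinner_e c_in)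
  then have "H \<subseteq> W"
    using a proj_on_in[OF closed_csubspace_closed_span, of "f ` words N"] by (metis scaleC_one subsetI)
  then show "W = H"
    using invariant_W unfolding invariant_def by blast
qed

subsection \<open>The reversing case\<close>

lemma word_V_scaleC: "w \<in> words N \<Longrightarrow> x \<in> K \<Longrightarrow> word_op V w (a *\<^sub>C x) = a *\<^sub>C word_op V w x"
  by (induction w) (simp_all add: bounded_op_onD(3)[OF bounded_V] word_V_in)

context
  assumes reversing: "reversing N V M g \<nu> e"
begin

text \<open>Reversing retraces each step of nonzero weight, the last letter first. For a loop at
  \<open>c\<close> this makes \<open>e c\<close> an eigenvector.\<close>

lemma word_V_walk:
  "w \<in> words N \<Longrightarrow> d \<in> M \<Longrightarrow> walk_wt g \<nu> w d \<noteq> 0 \<Longrightarrow>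
    word_op V w (e (walk_pt g w d)) = cnj (walk_wt g \<nu> w d) *\<^sub>C e d"
proof (induction w arbitrary: d)
  case (Cons i w)
  then have "word_op V w (e (walk_pt g w (g i d))) = cnj (walk_wt g \<nu> w (g i d)) *\<^sub>C e (g i d)"
    by (simp add: g_in)
  moreover have "V i (e (g i d)) = cnj (\<nu> i d) *\<^sub>C e d"
    using reversing Cons.prems unfolding reversing_def by simp
  ultimately show ?case
    using Cons.prems by (simp add: bounded_op_onD(3)[OF bounded_V] e_in_K g_in scaleC_scaleC mult.commute)
qed (simp add: scaleC_one)

lemma cinner_f_append_cycle:
  assumes w: "w \<in> words N" and \<beta>: "cyc \<beta>" and v: "v \<in> K"
  shows "cinner (f (w @ \<beta>)) v = cnj (walk_wt g \<nu> \<beta> c) * cinner (f w) v"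
proof -
  have "word_op V \<beta> (e c) = cnj (walk_wt g \<nu> \<beta> c) *\<^sub>C e c"
    using word_V_walk[of \<beta> c] cycD[OF \<beta>] c_in by simp
  then have "word_op V (w @ \<beta>) (e c) = cnj (walk_wt g \<nu> \<beta> c) *\<^sub>C word_op V w (e c)"
    by (simp add: word_op_append word_V_scaleC[OF w] e_in_K c_in)
  then show ?thesis
    using cinner_word_V[of "w @ \<beta>" "e c" v] cinner_word_V[of w "e c" v] w v cycD(1)[OF \<beta>]
    by (simp add: e_in_K c_in cinner_scaleC_left)
qed

text \<open>For \<open>v = w\<close> the common prefix cancels and the loop contributes its weight.
  For \<open>v \<noteq> w\<close> recurrence expands \<open>f v\<close> over the words
  \<open>v @ \<gamma>\<close>; they lie in the class of \<open>w @ \<beta>\<close> and differ from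
  it by the suffix code property, so both sides are 0.\<close>

lemma cinner_f_append_cycle_f:
  assumes w: "w \<in> \<Omega> n" and \<beta>: "cyc \<beta>" and v: "v \<in> \<Omega> n"
  shows "cinner (f (w @ \<beta>)) (f v) = cnj (walk_wt g \<nu> \<beta> c) * cinner (f w) (f v)"
proof (cases "v = w")
  case True
  have "cinner (f (w @ \<beta>)) (f w) = cinner (f \<beta>) (e c)"
    using \<Omega>_words[OF w] cycD(1)[OF \<beta>]
    by (simp add: word_op_append cinner_word_word f_in e_in_H c_in)
  also have "\<dots> = cnj (walk_wt g \<nu> \<beta> c)"
    using cinner_e_word[OF cycD(1)[OF \<beta>] c_in c_in] cycD(3)[OF \<beta>] cinner_commute[of "f \<beta>" "e c"] by simp
  finally show ?thesis using True orthonormal_\<Omega>[OF w w] by simp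
next
  case False
  have "cinner (f (w @ \<beta>)) (f v) = 0"
  proof (rule orth_closed_span[OF f_in_closed_span_cycles[OF \<Omega>_words[OF v]]], clarify)
    fix \<gamma> assume "cyc \<gamma>"
    then have "w @ \<beta> \<in> \<Omega> (Suc n)" "v @ \<gamma> \<in> \<Omega> (Suc n)" "w @ \<beta> \<noteq> v @ \<gamma>"
      using w v \<beta> False cyc_suffix_unique(1) unfolding \<Omega>_Suc by blast+
    then show "cinner (f (w @ \<beta>)) (f (v @ \<gamma>)) = 0"
      using orthonormal_\<Omega> by simp
  qed
  then show ?thesis using orthonormal_\<Omega>[OF w v] False by simp
qed

text \<open>By the two preceding lemmas each generator \<open>f (w @ \<beta>)\<close> of the larger
  space differs from a multiple of \<open>f w\<close> by a vector orthogonal to \<open>v\<close> and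
  to \<open>Hc n\<close>. Hence the residual of \<open>v\<close> at level \<open>n\<close> is
  already orthogonal to the larger space.\<close>

lemma proj_on_Hc_Suc:
  assumes v: "v \<in> K"
  shows "proj_on (Hc (Suc n)) v = proj_on (Hc n) v"
proof (rule proj_on_eqI[OF closed_csubspace_closed_span])
  let ?p = "proj_on (Hc n) v"
  have p: "?p \<in> Hc n" by (simp add: proj_on_in)
  then show "?p \<in> Hc (Suc n)" using Hc_Suc by blast
  fix x assume x: "x \<in> Hc (Suc n)"
  show "cinner (v - ?p) x = 0"
  proof (rule orth_closed_span[OF x], clarify)
    fix u assume "u \<in> \<Omega> (Suc n)"
    then obtain w \<beta> where u: "u = w @ \<beta>" "w \<in> \<Omega> n" "cyc \<beta>" unfolding \<Omega>_Suc by blast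
    define a where "a = cnj (walk_wt g \<nu> \<beta> c)"
    have "cinner (f u - a *\<^sub>C f w) ?p = 0"
      using cinner_f_append_cycle_f[OF u(2,3)] unfolding u(1)
      by (intro orth_closed_span[OF p]) (auto simp: cinner.diff_left cinner_scaleC_left a_def)
    moreover have "cinner (f u - a *\<^sub>C f w) v = 0"
      using cinner_f_append_cycle[OF \<Omega>_words[OF u(2)] u(3) v]
      by (simp add: u(1) cinner.diff_left cinner_scaleC_left a_def)
    moreover have "cinner (f w) (v - ?p) = 0"
      using proj_on_orth[OF closed_csubspace_closed_span closed_span_base, of "f w" "f ` \<Omega> n" v] u(2)
        cinner_eq_0_commute by blast
    ultimately have "cinner (f u) (v - ?p) = 0"
      by (simp add: cinner.diff_left cinner.diff_right cinner_scaleC_left)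
    then show "cinner (v - ?p) (f u) = 0" using cinner_eq_0_commute by blast
  qed
qed

lemma proj_on_Hc: "v \<in> K \<Longrightarrow> proj_on (Hc n) v = proj_on (Hc 0) v"
  by (induction n) (simp_all add: proj_on_Hc_Suc)

text \<open>Every word belongs to some class, and the residual of \<open>v\<close> is the same at
  all levels.\<close>

lemma proj_on_W:
  assumes v: "v \<in> K"
  shows "proj_on W v = proj_on (Hc 0) v"
proof (rule proj_on_eqI[OF closed_csubspace_closed_span])
  show "proj_on (Hc 0) v \<in> W"
    using proj_on_in[of "Hc 0" v] Hc_sub_W by auto
  fix x assume x: "x \<in> W"
  show "cinner (v - proj_on (Hc 0) v) x = 0"
  proof (rule orth_closed_span[OF x], clarify)
    fix w assume "w \<in> words N"
    then obtain n where "w \<in> \<Omega> n" unfolding UN_\<Omega>[symmetric] by blast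
    then have "f w \<in> Hc n"
      by (intro closed_span_base imageI)
    then show "cinner (v - proj_on (Hc 0) v) (f w) = 0"
      using proj_on_orth[OF closed_csubspace_closed_span, of "f w" "f ` \<Omega> n" v]
      unfolding proj_on_Hc[OF v, where n = n] by blast
  qed
qed

lemma has_sum_proj_W:
  assumes v: "v \<in> K"
  shows "((\<lambda>w. (cmod (cinner (word_op V w (e c)) v))\<^sup>2) has_sum (norm (proj_on W v))\<^sup>2) (\<Omega> 0)"
  unfolding proj_on_W[OF v]
proof (rule has_sum_cong[THEN iffD1, OF _ orthonormal_basis_has_sum[OF orthonormal_basis_Hc]])
  fix w assume "w \<in> \<Omega> 0"
  then show "(cmod (cinner (f w) v))\<^sup>2 = (cmod (cinner (word_op V w (e c)) v))\<^sup>2"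
    using v by (simp add: cinner_word_V \<Omega>_words e_in_K c_in)
qed

text \<open>On \<open>K\<close> the frame sum is the squared norm of the projection onto
  \<open>W\<close>. The frame condition thus says that this projection preserves norms on
  \<open>K\<close>, so that \<open>K\<close> lies in \<open>W\<close>; cyclicity then gives all of
  \<open>H\<close>.\<close>

lemma W_eq_H_iff_parseval:
  "W = H \<longleftrightarrow> parseval_frame (\<Omega> 0) (\<lambda>w. word_op V w (e c)) K"
proof
  assume "W = H"
  then have "(norm v)\<^sup>2 = (norm (proj_on W v))\<^sup>2" if "v \<in> K" for v
    using that K_sub by (simp add: proj_on_id closed_H)
  then show "parseval_frame (\<Omega> 0) (\<lambda>w. word_op V w (e c)) K"
    using has_sum_proj_W word_V_in[OF \<Omega>_words e_in_K[OF c_in]] unfolding parseval_frame_def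
    by (simp add: cmod_cinner_commute)
next
  assume frame: "parseval_frame (\<Omega> 0) (\<lambda>w. word_op V w (e c)) K"
  have "v \<in> W" if v: "v \<in> K" for v
  proof -
    have "((\<lambda>w. (cmod (cinner (word_op V w (e c)) v))\<^sup>2) has_sum (norm v)\<^sup>2) (\<Omega> 0)"
      using frame v unfolding parseval_frame_def by (subst cmod_cinner_commute) blast
    then have "(norm v)\<^sup>2 = (norm (proj_on W v))\<^sup>2"
      using has_sum_proj_W[OF v] infsumI by metis
    then have "v - proj_on W v = 0"
      using norm_sq_proj_on[of W v] by simp
    then show ?thesis
      using proj_on_in[of W v] by simp
  qed
  moreover have W_inv: "S i x \<in> W" if "i < N" "x \<in> W" for i x
    using invariant_W that unfolding invariant_def by blast
  ultimately have "word_op S w x \<in> W" if "w \<in> words N" "x \<in> K" for w x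
    using that by (induction w) auto
  then have "H \<subseteq> W"
    unfolding closed_span_words[symmetric] by (intro closed_span_minimal) auto
  then show "W = H"
    using invariant_W unfolding invariant_def by blast
qed

end

end

section \<open>Assembly of the statements (a) to (e) and of the equivalences\<close>

theorem theorem3p1:
  fixes N :: nat
    and K H K0 :: "'h::chilbert_space set"
    and V S :: "nat \<Rightarrow> 'h \<Rightarrow> 'h"
    and M :: "'m set"
    and g :: "nat \<Rightarrow> 'm \<Rightarrow> 'm"
    and \<nu> :: "nat \<Rightarrow> 'm \<Rightarrow> complex"
    and e :: "'m \<Rightarrow> 'h"
    and c :: 'm
  defines "\<Omega>c \<equiv> cycle_ending_words N g \<nu> c"
    and "Ec \<equiv> \<lambda>n. (\<lambda>\<omega>. word_op S \<omega> (e c)) ` cycle_ending_words N g \<nu> c n"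
    and "Hc \<equiv> \<lambda>n. closed_span ((\<lambda>\<omega>. word_op S \<omega> (e c)) ` cycle_ending_words N g \<nu> c n)"
    and "W \<equiv> closed_span ((\<lambda>\<omega>. word_op S \<omega> (e c)) ` words N)"
  assumes "N \<ge> 2"
    and "row_coisometry N K V"
    and "cuntz_dilation N K V H S"
    and "closed_csubspace K0" and "K0 \<subseteq> K"
    and "acts_as_random_walk N K V K0 M g \<nu> e"
    and "irreducible_walk N M g \<nu>"
    and "simple_on N K V K0"
    and "c \<in> M"
  shows "
    \<comment> \<open>(a)\<close> (\<forall>n. orthonormal_basis (\<Omega>c n) (\<lambda>\<omega>. word_op S \<omega> (e c)) (Hc n)) \<and>
    \<comment> \<open>(b)\<close> (\<forall>n. Hc n \<subseteq> Hc (n + 1)) \<and>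
    \<comment> \<open>(c)\<close> (\<Union>n. Ec n) = (\<lambda>\<omega>. word_op S \<omega> (e c)) ` words N \<and>
    \<comment> \<open>(d)\<close> W = closure (\<Union>n. Hc n) \<and>
            (\<forall>i<N. S i ` W \<subseteq> W \<and> adj_on H (S i) ` W \<subseteq> W) \<and>
            cuntz_dilation N K0 (\<lambda>i x. proj_on K0 (V i (proj_on K0 x))) W S \<and>
            irreducible_rep N W S \<and>
    \<comment> \<open>(i) iff (ii)\<close> (W = H \<longleftrightarrow> irreducible_rep N H S) \<and>
    \<comment> \<open>(ii) iff (iii)\<close>
            (irreducible_rep N H S \<longleftrightarrow>
              (\<forall>T. bounded_op_on K T \<and>
                   (\<forall>x\<in>K. (\<Sum>i<N. V i (T (adj_on K (V i) x))) = T x)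
                   \<longrightarrow> scalar_on K T)) \<and>
    (reversing N V M g \<nu> e \<longrightarrow>
    \<comment> \<open>(e)\<close> (\<forall>n. \<forall>v\<in>K.
              ((\<lambda>\<omega>. (cmod (cinner (word_op V \<omega> (e c)) v))\<^sup>2) has_sum
                 (norm (proj_on (Hc n) v))\<^sup>2) (\<Omega>c 0) \<and>
              (norm (proj_on (Hc n) v))\<^sup>2 = (norm (proj_on (Hc 0) v))\<^sup>2 \<and>
              (norm (proj_on (Hc 0) v))\<^sup>2 = (norm (proj_on W v))\<^sup>2) \<and>
    \<comment> \<open>(i) iff (iv)\<close>
            (W = H \<longleftrightarrow> parseval_frame (\<Omega>c 0) (\<lambda>\<omega>. word_op V \<omega> (e c)) K))"
proof -
  interpret random_walk N H S K V K0 M g \<nu> e c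
    using assms by unfold_locales (simp_all add: cuntz_dilation_def)
  note simple = \<open>simple_on N K V K0\<close>
  show ?thesis
    unfolding Hc_def W_def \<Omega>c_def Ec_def
  proof (intro conjI allI impI ballI)
    fix n
    let ?H = "\<lambda>n. closed_span ((\<lambda>\<omega>. word_op S \<omega> (e c)) ` \<Omega> n)"
    let ?W = "closed_span ((\<lambda>\<omega>. word_op S \<omega> (e c)) ` words N)"
    show "orthonormal_basis (\<Omega> n) (\<lambda>\<omega>. word_op S \<omega> (e c)) (?H n)"
      by (rule orthonormal_basis_Hc)
    show "?H n \<subseteq> ?H (n + 1)"
      unfolding Suc_eq_plus1[symmetric] by (rule Hc_Suc)
    show "(\<Union>n. (\<lambda>\<omega>. word_op S \<omega> (e c)) ` \<Omega> n) = (\<lambda>\<omega>. word_op S \<omega> (e c)) ` words N"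
      by (simp only: UN_\<Omega> flip: image_UN)
    show "?W = closure (\<Union>n. ?H n)"
      by (rule W_eq)
    show "S i ` ?W \<subseteq> ?W" "Sa i ` ?W \<subseteq> ?W" if "i < N" for i
      using invariant_W that unfolding invariant_def by blast+
    show "cuntz_dilation N K0 V0 ?W S"
      by (rule cuntz_dilation_W)
    show "irreducible_rep N ?W S"
      by (rule irreducible_rep_W[OF simple])
    show "?W = H \<longleftrightarrow> irreducible_rep N H S"
      by (rule W_eq_H_iff[OF simple])
    show "irreducible_rep N H S \<longleftrightarrow>
        (\<forall>T. bounded_op_on K T \<and> (\<forall>x\<in>K. (\<Sum>i<N. V i (T (adj_on K (V i) x))) = T x)
          \<longrightarrow> scalar_on K T)"
      \<comment> \<open>On \<open>K\<close> the adjoints of \<open>V i\<close> and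
        \<open>S i\<close> agree, so (iii) is the fixed point condition of the dilation.\<close>
      unfolding irreducible_iff_fixed_points_scalar fixed_point_def by (simp add: adj_V)
    assume rev: "reversing N V M g \<nu> e"
    show "?W = H \<longleftrightarrow> parseval_frame (\<Omega> 0) (\<lambda>\<omega>. word_op V \<omega> (e c)) K"
      by (rule W_eq_H_iff_parseval[OF rev])
    fix v assume v: "v \<in> K"
    show "((\<lambda>\<omega>. (cmod (cinner (word_op V \<omega> (e c)) v))\<^sup>2) has_sum
        (norm (proj_on (?H n) v))\<^sup>2) (\<Omega> 0)"
      using has_sum_proj_W[OF rev v]
      unfolding proj_on_W[OF rev v] proj_on_Hc[OF rev v, where n = n] .
    show "(norm (proj_on (?H n) v))\<^sup>2 = (norm (proj_on (?H 0) v))\<^sup>2"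
      by (simp only: proj_on_Hc[OF rev v, where n = n])
    show "(norm (proj_on (?H 0) v))\<^sup>2 = (norm (proj_on ?W v))\<^sup>2"
      by (simp only: proj_on_W[OF rev v])
  qed
qed

end
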